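(* Let $0<\alpha<\pi/2$. Then $PW_\alpha$ is a reproducing kernel Hilbert space. Its reproducing kernel is given, for $(m,n),(u,v)\in\mathbb Z^2$, by $$K_{(m,n)}(u,v)=\frac{1}{2\pi}\int_{D_\alpha} e_t(u-m,v+n)\, dt=\frac{1}{2\pi}\int_{D_\alpha} e^{i(u-m)t}\bigg(\frac{1+ie^{it}}{i+e^{it}}\bigg)^{v+n}\, dt.$$
   Context: The torus $\mathbb T=\mathbb R/2\pi\mathbb Z$ is identified with $[-\pi,\pi)$. A function $F:\mathbb Z^2\to\mathbb C$ is (discrete) entire if $F(m+1,n+1)-F(m,n)=-i\big(F(m,n+1)-F(m+1,n)\big)$ for every $(m,n)\in\mathbb Z^2$. For $t\in\mathbb T$, $t\neq\pm\pi/2$, the discrete exponential is $e_t:\mathbb Z^2\to\mathbb C$, $e_t(m,n)=e^{itm}\Big(\frac{1+ie^{it}}{i+e^{it}}\Big)^n$. For $0<\alpha<\pi/2$, $D_\alpha=\{t\in\mathbb T: |t|\leqslant\alpha\}\cup\{t\in\mathbb T:\pi-\alpha\leqslant|t|\leqslant\pi\}$. The space $PW_\alpha$ is the set of all entire $F:\mathbb Z^2\to\mathbb C$ such that (i) there exists $c>0$ with $|F(m,n)|\leqslant c\,|e_{-\alpha}(0,1)|^{|n|}$ for every $(m,n)\in\mathbb Z^2$, and (ii) $\sum_{m\in\mathbb Z}|F(m,0)|^2<+\infty$; it is endowed with the norm $\|F\|_{PW_\alpha}^2=\sum_{m\in\mathbb Z}|F(m,0)|^2$ and the associated inner product $\langle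 F,G\rangle_{PW_\alpha}=\sum_{u\in\mathbb Z}F(u,0)\overline{G(u,0)}$. The reproducing kernel is the family $K_{(m,n)}\in PW_\alpha$ with $F(m,n)=\langle F,K_{(m,n)}\rangle_{PW_\alpha}$ for every $F\in PW_\alpha$ and $(m,n)\in\mathbb Z^2$. *)

theory Defs
  imports "HOL-Analysis.Analysis" "HOL-Library.Function_Algebras"
begin

subsection \<open>Complex Hilbert spaces of functions\<close>

global_interpretation fun_cvs: vector_space "\<lambda>(c::complex) (F::'x \<Rightarrow> complex) x. c * F x"
  defines csubspace = fun_cvs.subspace
  by unfold_locales (auto simp: fun_eq_iff algebra_simps)

text \<open>All linear operations on functions are pointwise; the inner product is linear in its
  first argument. As \<open>nrm\<close> is nonnegative, \<open>inner_self\<close> also says that \<open>ip F F\<close> is real and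
  nonnegative.\<close>

locale complex_inner_product_on =
  fixes V :: "('x \<Rightarrow> complex) set"
    and ip :: "('x \<Rightarrow> complex) \<Rightarrow> ('x \<Rightarrow> complex) \<Rightarrow> complex"
    and nrm :: "('x \<Rightarrow> complex) \<Rightarrow> real"
  assumes subspace: "csubspace V"
    and inner_add: "\<lbrakk>F \<in> V; G \<in> V; H \<in> V\<rbrakk> \<Longrightarrow> ip (F + G) H = ip F H + ip G H"
    and inner_scale: "\<lbrakk>F \<in> V; G \<in> V\<rbrakk> \<Longrightarrow> ip (\<lambda>x. c * F x) G = c * ip F G"
    and inner_commute: "\<lbrakk>F \<in> V; G \<in> V\<rbrakk> \<Longrightarrow> ip G F = cnj (ip F G)"
    and nrm_nonneg: "F \<in> V \<Longrightarrow> 0 \<le> nrm F"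
    and inner_self: "F \<in> V \<Longrightarrow> ip F F = complex_of_real ((nrm F)\<^sup>2)"
    and nrm_zero: "F \<in> V \<Longrightarrow> nrm F = 0 \<Longrightarrow> F = 0"

locale complex_hilbert_on = complex_inner_product_on V ip nrm
  for V :: "('x \<Rightarrow> complex) set" and ip and nrm +
  assumes metric: "Metric_space V (\<lambda>F G. nrm (F - G))"
    and complete: "Metric_space.mcomplete V (\<lambda>F G. nrm (F - G))"

text \<open>A reproducing kernel Hilbert space is a Hilbert space of functions whose point
  evaluations are bounded linear functionals.\<close>

locale rkhs = complex_hilbert_on V ip nrm
  for V :: "('x \<Rightarrow> complex) set" and ip and nrm +
  assumes bounded_eval: "\<exists>C. \<forall>F\<in>V. cmod (F x) \<le> C * nrm F"

definition reproducing_kernel ::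
  "('x \<Rightarrow> complex) set \<Rightarrow> (('x \<Rightarrow> complex) \<Rightarrow> ('x \<Rightarrow> complex) \<Rightarrow> complex) \<Rightarrow>
    ('x \<Rightarrow> 'x \<Rightarrow> complex) \<Rightarrow> bool" where
  "reproducing_kernel V ip K \<longleftrightarrow>
    (\<forall>x. K x \<in> V) \<and> (\<forall>F\<in>V. \<forall>x. F x = ip F (K x))"

subsection \<open>The discrete Paley--Wiener space\<close>

definition discrete_entire :: "(int \<times> int \<Rightarrow> complex) \<Rightarrow> bool" where
  "discrete_entire F \<longleftrightarrow>
    (\<forall>m n. F (m + 1, n + 1) - F (m, n) = - \<i> * (F (m, n + 1) - F (m + 1, n)))"

text \<open>The parameter \<open>t\<close> is a real representative of a point of the torus. For
  \<open>t = \<plusminus>\<pi>/2\<close> modulo \<open>2\<pi>\<close>, where the base of the second power is infinite or zero, the value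
  is a dummy.\<close>

definition discrete_exp :: "real \<Rightarrow> int \<times> int \<Rightarrow> complex" where
  "discrete_exp t = (\<lambda>(m, n). exp (\<i> * t * of_int m) *
    ((1 + \<i> * exp (\<i> * t)) / (\<i> + exp (\<i> * t))) powi n)"

definition D_set :: "real \<Rightarrow> real set" where
  "D_set \<alpha> = {t \<in> {-pi..<pi}. \<bar>t\<bar> \<le> \<alpha>} \<union> {t \<in> {-pi..<pi}. pi - \<alpha> \<le> \<bar>t\<bar> \<and> \<bar>t\<bar> \<le> pi}"

definition PW :: "real \<Rightarrow> (int \<times> int \<Rightarrow> complex) set" where
  "PW \<alpha> = {F. discrete_entire F \<and>
    (\<exists>c>0. \<forall>m n. cmod (F (m, n)) \<le> c * cmod (discrete_exp (- \<alpha>) (0, 1)) ^ nat \<bar>n\<bar>) \<and>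
    (\<lambda>m. (cmod (F (m, 0)))\<^sup>2) summable_on UNIV}"

definition PW_norm :: "(int \<times> int \<Rightarrow> complex) \<Rightarrow> real" where
  "PW_norm F = sqrt (\<Sum>\<^sub>\<infinity>m. (cmod (F (m, 0)))\<^sup>2)"

definition PW_inner :: "(int \<times> int \<Rightarrow> complex) \<Rightarrow> (int \<times> int \<Rightarrow> complex) \<Rightarrow> complex" where
  "PW_inner F G = (\<Sum>\<^sub>\<infinity>u. F (u, 0) * cnj (G (u, 0)))"

end

theory Submission
  imports Defs
begin

text \<open>Write the entire equation as \<open>(\<i> + S) F(\<cdot>, n + 1) = (1 + \<i> S) F(\<cdot>, n)\<close>, where \<open>S\<close> shifts the
first variable. On the Fourier side \<open>S\<close> is multiplication by \<open>e\<^sup>i\<^sup>t\<close>, so passing from row \<open>n\<close> to row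
\<open>n + 1\<close> multiplies by \<open>\<lambda>(t) = (1 + \<i> e\<^sup>i\<^sup>t) / (\<i> + e\<^sup>i\<^sup>t)\<close>. This function is real, and with
\<open>\<rho> = |\<lambda>(-\<alpha>)| > 1\<close> the set \<open>D\<^sub>\<alpha>\<close> is exactly where \<open>1/\<rho> \<le> |\<lambda>| \<le> \<rho>\<close>. The theorem says that growth at
rate \<open>\<rho>\<close> in \<open>n\<close> is the same as the spectrum of the axis values lying in \<open>D\<^sub>\<alpha>\<close>.

The heart is the Paley--Wiener direction. For an axis sequence \<open>f \<in> \<ell>\<^sup>2\<close> and a bounded function \<open>h\<close> on
the torus, let \<open>pairing f h\<close> be the sum of \<open>f u\<close> times the \<open>u\<close>-th Fourier coefficient of \<open>h\<close>; this is
continuous in the \<open>L\<^sup>2\<close> norm of \<open>h\<close> by Bessel's inequality (\<open>fourier_coeff_Bessel\<close>), and it returns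
\<open>f m\<close> at \<open>h = e\<^sup>i\<^sup>m\<^sup>t\<close>. The rows other than the axis are only bounded in \<open>m\<close>, so they may be paired
only with functions whose Fourier coefficients are absolutely summable: \<open>C\<^sup>1\<close> functions on an interval
that vanish at its ends (\<open>fourier_coeff_abs_summable\<close>). Let \<open>g\<close> be such a function on an interval where
\<open>|\<lambda>| > \<rho>\<close>. Then \<open>g\<close> paired with row \<open>0\<close> equals \<open>\<lambda>\<^sup>-\<^sup>n g\<close> paired with row \<open>n\<close>; the row grows at most like
\<open>\<rho>\<^sup>n\<close>, while the coefficients of \<open>\<lambda>\<^sup>-\<^sup>n g\<close> decay like \<open>n q\<^sup>n\<close> with \<open>q < 1/\<rho>\<close>, so the pairing is zero
(\<open>growth_annihilates\<close>). The rows \<open>-n\<close> handle \<open>|\<lambda>| < 1/\<rho>\<close> in the same way. Hence the axis values of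
\<open>F \<in> PW\<^sub>\<alpha>\<close> do not change when \<open>e\<^sup>i\<^sup>m\<^sup>t\<close> is cut down to \<open>D\<^sub>\<alpha>\<close> (\<open>extension_axis\<close>).

Pairing the axis values with \<open>1\<^bsub>D\<^esub> e\<^sub>t(m,n)\<close> therefore gives an entire function with the axis values and
the growth of \<open>F\<close>. A function in \<open>PW\<^sub>\<alpha>\<close> is determined by its axis values, because the homogeneous
solutions that may be added to one row force linear growth in \<open>m\<close> in the next row
(\<open>entire_vanishing_axis\<close>). So \<open>F(m,n) = pairing F(\<cdot>,0) (1\<^bsub>D\<^esub> e\<^sub>t(m,n))\<close> (\<open>PW_representation\<close>), and since
\<open>\<lambda>\<close> is real this is the inner product of \<open>F\<close> with the asserted kernel. It also gives
\<open>|F(m,n)| \<le> \<parallel>F\<parallel> \<rho>\<^bsup>|n|\<^esup>\<close>, hence bounded evaluations and, by passing to pointwise limits, completeness.\<close>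

section \<open>Square summable families\<close>

definition l2 :: "('i \<Rightarrow> complex) \<Rightarrow> bool" where
  "l2 f \<longleftrightarrow> (\<lambda>u. (cmod (f u))\<^sup>2) summable_on UNIV"

definition l2norm :: "('i \<Rightarrow> complex) \<Rightarrow> real" where
  "l2norm f = sqrt (\<Sum>\<^sub>\<infinity>u. (cmod (f u))\<^sup>2)"

lemma l2norm_nonneg [simp]: "0 \<le> l2norm f"
  by (simp add: l2norm_def infsum_nonneg)

lemma l2norm_power2: "(l2norm f)\<^sup>2 = (\<Sum>\<^sub>\<infinity>u. (cmod (f u))\<^sup>2)"
  by (simp add: l2norm_def infsum_nonneg)

lemma L2_set_le_l2norm:
  assumes "l2 f" "finite U"
  shows "L2_set (\<lambda>u. cmod (f u)) U \<le> l2norm f"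
  unfolding L2_set_def l2norm_def
  by (intro real_sqrt_le_mono finite_sum_le_infsum) (use assms in \<open>auto simp: l2_def\<close>)

text \<open>Membership and the norm are both read off from finite partial sums, so that the finite-dimensional
inequalities of Cauchy--Schwarz and Minkowski pass to the limit without any manipulation of
infinite sums.\<close>
lemma l2_bounded_L2_set:
  assumes "\<And>U. finite U \<Longrightarrow> L2_set (\<lambda>u. cmod (f u)) U \<le> B"
  shows "l2 f" and "l2norm f \<le> B"
proof -
  have B: "0 \<le> B" using assms[of "{}"] by simp
  have *: "(\<Sum>u\<in>U. (cmod (f u))\<^sup>2) \<le> B\<^sup>2" if "finite U" for U
    using assms[OF that] B unfolding L2_set_def
    by (metis real_sqrt_le_iff real_sqrt_unique)
  show "l2 f"
    unfolding l2_def using * by (intro nonneg_bounded_partial_sums_imp_summable_on[of _ _ "B\<^sup>2"])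
      (auto simp: eventually_finite_subsets_at_top)
  then have "(\<Sum>\<^sub>\<infinity>u. (cmod (f u))\<^sup>2) \<le> B\<^sup>2"
    unfolding l2_def by (rule infsum_le_finite_sums) (use * in auto)
  then show "l2norm f \<le> B"
    unfolding l2norm_def using B by (simp add: real_le_lsqrt infsum_nonneg)
qed

lemma l2_add:
  assumes "l2 f" "l2 g"
  shows "l2 (\<lambda>u. f u + g u)" and "l2norm (\<lambda>u. f u + g u) \<le> l2norm f + l2norm g"
proof -
  have *: "L2_set (\<lambda>u. cmod (f u + g u)) U \<le> l2norm f + l2norm g" if "finite U" for U
  proof -
    have "L2_set (\<lambda>u. cmod (f u + g u)) U \<le> L2_set (\<lambda>u. cmod (f u) + cmod (g u)) U"
      by (intro L2_set_mono) (auto simp: norm_triangle_ineq)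
    also have "\<dots> \<le> L2_set (\<lambda>u. cmod (f u)) U + L2_set (\<lambda>u. cmod (g u)) U"
      by (rule L2_set_triangle_ineq)
    finally show ?thesis using L2_set_le_l2norm[OF assms(1) that] L2_set_le_l2norm[OF assms(2) that]
      by linarith
  qed
  show "l2 (\<lambda>u. f u + g u)" "l2norm (\<lambda>u. f u + g u) \<le> l2norm f + l2norm g"
    using l2_bounded_L2_set[of "\<lambda>u. f u + g u", OF *] by auto
qed

lemma l2_scale: "l2 f \<Longrightarrow> l2 (\<lambda>u. c * f u)"
  unfolding l2_def by (simp add: norm_mult power_mult_distrib summable_on_cmult_right)

lemma l2_diff:
  assumes "l2 f" "l2 g"
  shows "l2 (\<lambda>u. f u - g u)"
  using l2_add(1)[OF assms(1) l2_scale[OF assms(2), of "-1"]] by simp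

lemma l2norm_minus_commute: "l2norm (\<lambda>u. f u - g u) = l2norm (\<lambda>u. g u - f u)"
  by (simp add: l2norm_def norm_minus_commute)

lemma l2_cnj [simp]: "l2 (\<lambda>u. cnj (f u)) = l2 f" "l2norm (\<lambda>u. cnj (f u)) = l2norm f"
  by (simp_all add: l2_def l2norm_def)

lemma l2_Cauchy_Schwarz:
  assumes "l2 f" "l2 g"
  shows "(\<lambda>u. cmod (f u * g u)) summable_on UNIV"
    and "(\<Sum>\<^sub>\<infinity>u. cmod (f u * g u)) \<le> l2norm f * l2norm g"
    and "(\<lambda>u. f u * g u) summable_on UNIV"
    and "cmod (\<Sum>\<^sub>\<infinity>u. f u * g u) \<le> l2norm f * l2norm g"
proof -
  have *: "(\<Sum>u\<in>U. cmod (f u * g u)) \<le> l2norm f * l2norm g" if "finite U" for U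
  proof -
    have "(\<Sum>u\<in>U. cmod (f u * g u)) \<le> L2_set (\<lambda>u. cmod (f u)) U * L2_set (\<lambda>u. cmod (g u)) U"
      using L2_set_mult_ineq[of "\<lambda>u. cmod (f u)" "\<lambda>u. cmod (g u)" U] by (simp add: norm_mult)
    also have "\<dots> \<le> l2norm f * l2norm g"
      by (intro mult_mono L2_set_le_l2norm assms that) (auto simp: L2_set_nonneg)
    finally show ?thesis .
  qed
  show abs: "(\<lambda>u. cmod (f u * g u)) summable_on UNIV"
    using * by (intro nonneg_bounded_partial_sums_imp_summable_on[of _ _ "l2norm f * l2norm g"])
      (auto simp: eventually_finite_subsets_at_top)
  then show le: "(\<Sum>\<^sub>\<infinity>u. cmod (f u * g u)) \<le> l2norm f * l2norm g"
    by (rule infsum_le_finite_sums) (use * in auto)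
  show "(\<lambda>u. f u * g u) summable_on UNIV"
    by (rule abs_summable_summable[OF abs])
  show "cmod (\<Sum>\<^sub>\<infinity>u. f u * g u) \<le> l2norm f * l2norm g"
    using norm_infsum_bound[OF abs] le by linarith
qed

text \<open>A Fatou lemma. Applied to the differences \<open>f k - f k'\<close> of a Cauchy sequence, with \<open>k\<close> fixed, it
turns pointwise convergence into convergence in norm.\<close>
lemma l2_pointwise_limit:
  assumes l2: "\<And>k. l2 (f k)" and lim: "\<And>u. (\<lambda>k. f k u) \<longlonglongrightarrow> g u"
    and bd: "\<And>k. N \<le> k \<Longrightarrow> l2norm (f k) \<le> B"
  shows "l2 g" and "l2norm g \<le> B"
proof -
  have "L2_set (\<lambda>u. cmod (g u)) U \<le> B" if "finite U" for U
  proof (rule tendsto_upperbound)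
    show "(\<lambda>k. L2_set (\<lambda>u. cmod (f k u)) U) \<longlonglongrightarrow> L2_set (\<lambda>u. cmod (g u)) U"
      unfolding L2_set_def by (intro tendsto_intros lim)
    show "\<forall>\<^sub>F k in sequentially. L2_set (\<lambda>u. cmod (f k u)) U \<le> B"
      using eventually_ge_at_top[of N]
      by eventually_elim (use L2_set_le_l2norm[OF l2 that] bd in \<open>fastforce intro: order_trans\<close>)
  qed simp
  from l2_bounded_L2_set[of g, OF this] show "l2 g" "l2norm g \<le> B" by auto
qed

section \<open>Fourier coefficients and Bessel's inequality\<close>

text \<open>Normalised to total mass one, so that the characters \<open>e\<^sup>i\<^sup>k\<^sup>t\<close> are orthonormal and a bound on a function
is a bound on its integral.\<close>
definition torus :: "real measure" where
  "torus = density lborel (\<lambda>t. ennreal (indicator {-pi..<pi} t / (2 * pi)))"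

lemma sets_torus [measurable_cong, simp]: "sets torus = sets borel"
  and space_torus [simp]: "space torus = UNIV"
  by (simp_all add: torus_def)

lemma integral_torus:
  fixes h :: "real \<Rightarrow> 'a :: {banach, second_countable_topology}"
  assumes [measurable]: "h \<in> borel_measurable borel"
  shows "(LINT t|torus. h t) = (1 / (2 * pi)) *\<^sub>R (LINT t:{-pi..<pi}|lborel. h t)"
proof -
  have "(LINT t|torus. h t) = (LINT t|lborel. (indicator {-pi..<pi} t / (2 * pi)) *\<^sub>R h t)"
    unfolding torus_def by (rule integral_density) (auto simp: indicator_def)
  also have "\<dots> = (LINT t|lborel. (1 / (2 * pi)) *\<^sub>R (indicator {-pi..<pi} t *\<^sub>R h t))"
    by (intro Bochner_Integration.integral_cong) auto
  also have "\<dots> = (1 / (2 * pi)) *\<^sub>R (LINT t:{-pi..<pi}|lborel. h t)"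
    unfolding set_lebesgue_integral_def by (rule integral_scaleR_right)
  finally show ?thesis .
qed

lemma emeasure_torus_UNIV: "emeasure torus UNIV = 1"
proof -
  have "emeasure torus UNIV = (\<integral>\<^sup>+ t. ennreal (1 / (2 * pi)) * indicator {-pi..<pi} t \<partial>lborel)"
    unfolding torus_def
    by (subst emeasure_density) (auto intro!: nn_integral_cong simp: indicator_def)
  also have "\<dots> = ennreal (1 / (2 * pi)) * emeasure lborel {-pi..<pi}"
    by (rule nn_integral_cmult_indicator) simp
  also have "\<dots> = 1" by (simp flip: ennreal_mult)
  finally show ?thesis .
qed

interpretation torus: finite_measure torus
  by standard (simp add: emeasure_torus_UNIV)

lemma measure_torus_UNIV [simp]: "measure torus UNIV = 1"
  by (simp add: measure_def emeasure_torus_UNIV)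

text \<open>A convenient algebra of functions inside \<open>L\<^sup>2\<close> of the torus: closed under products and large
enough for indicators of intervals. The bound is required at every real point, which spares all
almost-everywhere arguments.\<close>
definition bdd_borel :: "(real \<Rightarrow> complex) \<Rightarrow> bool" where
  "bdd_borel h \<longleftrightarrow> h \<in> borel_measurable borel \<and> (\<exists>B. \<forall>t. cmod (h t) \<le> B)"

lemma bdd_borel_measurable [measurable_dest]: "bdd_borel h \<Longrightarrow> h \<in> borel_measurable borel"
  by (simp add: bdd_borel_def)

lemma bdd_borel_integrable: "bdd_borel h \<Longrightarrow> integrable torus h"
  unfolding bdd_borel_def by (auto intro!: torus.integrable_const_bound)

lemma bdd_borel_mult: assumes "bdd_borel h" "bdd_borel k" shows "bdd_borel (\<lambda>t. h t * k t)"
proof -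
  obtain B C where B: "\<And>t. cmod (h t) \<le> B" and C: "\<And>t. cmod (k t) \<le> C"
    using assms unfolding bdd_borel_def by auto
  have "cmod (h t * k t) \<le> B * C" for t
    unfolding norm_mult by (intro mult_mono B C) (auto intro: order_trans[OF norm_ge_zero B])
  with assms show ?thesis unfolding bdd_borel_def by auto
qed

lemma bdd_borel_add: assumes "bdd_borel h" "bdd_borel k" shows "bdd_borel (\<lambda>t. h t + k t)"
proof -
  obtain B C where B: "\<And>t. cmod (h t) \<le> B" and C: "\<And>t. cmod (k t) \<le> C"
    using assms unfolding bdd_borel_def by auto
  have "cmod (h t + k t) \<le> B + C" for t
    using norm_triangle_ineq[of "h t" "k t"] B[of t] C[of t] by linarith
  with assms show ?thesis unfolding bdd_borel_def by auto
qed

lemma bdd_borel_const: "bdd_borel (\<lambda>t. c)" unfolding bdd_borel_def by auto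

lemma cis_borel [measurable]: "cis \<in> borel_measurable borel"
  by (intro borel_measurable_continuous_onI continuous_intros)

lemma borel_measurable_cis_mult [measurable]: "(\<lambda>t. cis (c * t)) \<in> borel_measurable borel"
  by (intro borel_measurable_continuous_onI continuous_intros)

lemma bdd_borel_cis: "bdd_borel (\<lambda>t. cis (c * t))"
  unfolding bdd_borel_def by (auto intro!: exI[of _ 1])

lemma bdd_borel_cnj: "bdd_borel h \<Longrightarrow> bdd_borel (\<lambda>t. cnj (h t))"
  unfolding bdd_borel_def
  by (auto intro: borel_measurable_continuous_on[of cnj, OF continuous_on_cnj[OF continuous_on_id]])

lemma bdd_borel_sum: "(\<And>i. i \<in> I \<Longrightarrow> bdd_borel (h i)) \<Longrightarrow> bdd_borel (\<lambda>t. \<Sum>i\<in>I. h i t)"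
  by (induction I rule: infinite_finite_induct) (auto intro: bdd_borel_const bdd_borel_add)

lemma bdd_borel_diff: assumes "bdd_borel h" "bdd_borel k" shows "bdd_borel (\<lambda>t. h t - k t)"
  using bdd_borel_add[OF assms(1) bdd_borel_mult[OF bdd_borel_const assms(2), of "-1"]] by simp

lemmas bdd_borel_intros = bdd_borel_mult bdd_borel_add bdd_borel_diff
  bdd_borel_const bdd_borel_cis bdd_borel_cnj bdd_borel_sum

lemma has_vector_derivative_cis_mult:
  "((\<lambda>t. cis (c * t)) has_vector_derivative \<i> * of_real c * cis (c * t)) (at t within S)"
proof -
  have "((\<lambda>z. exp (\<i> * of_real c * z)) has_field_derivative \<i> * of_real c * exp (\<i> * of_real c * of_real t))
      (at (of_real t))"
    by (auto intro!: derivative_eq_intros)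
  from has_vector_derivative_real_field[OF this] show ?thesis
    by (simp add: cis_conv_exp o_def mult.assoc)
qed

lemma integral_cis: "(LINT t|torus. cis (of_int k * t)) = (if k = 0 then 1 else 0)"
proof (cases "k = 0")
  case True then show ?thesis by simp
next
  case False
  have "(LINT t|torus. cis (of_int k * t)) =
      (1 / (2 * pi)) *\<^sub>R (LINT t|lborel. indicator {-pi..pi} t *\<^sub>R cis (of_int k * t))"
    unfolding integral_torus[OF borel_measurable_cis_mult] set_lebesgue_integral_def
    by (intro arg_cong[where f = "\<lambda>x. _ *\<^sub>R x"] integral_cong_AE)
      (use AE_lborel_singleton[of pi] in \<open>auto elim!: eventually_mono simp: indicator_def\<close>)
  also have "(LINT t|lborel. indicator {-pi..pi} t *\<^sub>R cis (of_int k * t)) =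
      cis (of_int k * pi) / (\<i> * of_int k) - cis (of_int k * (-pi)) / (\<i> * of_int k)"
  proof (rule integral_FTC_Icc)
    show "((\<lambda>t. cis (of_int k * t) / (\<i> * of_int k)) has_vector_derivative cis (of_int k * t))
        (at t within {- pi..pi})" for t
      using has_vector_derivative_divide[OF has_vector_derivative_cis_mult[of "of_int k" t], of "\<i> * of_int k"] False
      by simp
  qed (auto intro!: continuous_intros)
  also have "cis (of_int k * pi) = cis (of_int k * (-pi))"
  proof -
    have "cis (of_int k * (-pi)) * cis (2 * pi * of_int k) = cis (of_int k * pi)"
      by (subst cis_mult) (simp add: algebra_simps)
    then show ?thesis using cis_multiple_2pi[of "of_int k"] by simp
  qed
  finally show ?thesis using False by simp
qed

definition fourier_coeff :: "(real \<Rightarrow> complex) \<Rightarrow> int \<Rightarrow> complex" where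
  "fourier_coeff h u = (LINT t|torus. h t * cis (- of_int u * t))"

definition torus_norm :: "(real \<Rightarrow> complex) \<Rightarrow> real" where
  "torus_norm h = sqrt (LINT t|torus. (cmod (h t))\<^sup>2)"

lemma fourier_coeff_integrable: "bdd_borel h \<Longrightarrow> integrable torus (\<lambda>t. h t * cis (- of_int u * t))"
  by (intro bdd_borel_integrable bdd_borel_intros)

lemma fourier_coeff_add:
  "bdd_borel h \<Longrightarrow> bdd_borel k \<Longrightarrow>
    fourier_coeff (\<lambda>t. h t + k t) u = fourier_coeff h u + fourier_coeff k u"
  unfolding fourier_coeff_def distrib_right
    by (intro Bochner_Integration.integral_add fourier_coeff_integrable)

lemma fourier_coeff_scale: "fourier_coeff (\<lambda>t. c * h t) u = c * fourier_coeff h u"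
  unfolding fourier_coeff_def mult.assoc by simp

lemma fourier_coeff_cis_mult: "fourier_coeff (\<lambda>t. cis (of_int k * t) * h t) u = fourier_coeff h (u - k)"
proof -
  have "cis (- of_int (u - k) * t) = cis (of_int k * t) * cis (- of_int u * t)" for t
    by (subst cis_mult) (simp add: algebra_simps)
  then show ?thesis
    unfolding fourier_coeff_def by (intro Bochner_Integration.integral_cong) (simp_all add: mult_ac)
qed

lemma fourier_coeff_cis: "fourier_coeff (\<lambda>t. cis (of_int k * t)) u = (if u = k then 1 else 0)"
proof -
  have "fourier_coeff (\<lambda>t. cis (of_int k * t)) u = (LINT t|torus. cis (of_int (k - u) * t))"
    unfolding fourier_coeff_def
      by (intro Bochner_Integration.integral_cong) (simp_all add: cis_mult algebra_simps)
  then show ?thesis unfolding integral_cis by auto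
qed

lemma fourier_coeff_bound:
  assumes "h \<in> borel_measurable borel" "\<And>t. cmod (h t) \<le> B"
  shows "cmod (fourier_coeff h u) \<le> B"
proof -
  have bm: "bdd_borel h" using assms by (auto simp: bdd_borel_def)
  have "cmod (fourier_coeff h u) \<le> (LINT t|torus. cmod (h t * cis (- of_int u * t)))"
    unfolding fourier_coeff_def by (rule integral_norm_bound)
  also have "\<dots> \<le> (LINT t|torus. B)"
    using assms(2) integrable_norm[OF fourier_coeff_integrable[OF bm]]
    by (intro integral_mono) (auto simp: norm_mult)
  finally show ?thesis by simp
qed

lemma bdd_borel_square_integrable: assumes "bdd_borel h" shows "integrable torus (\<lambda>t. (cmod (h t))\<^sup>2)"
proof -
  have "integrable torus (\<lambda>t. cmod (h t * h t))"
    by (intro integrable_norm bdd_borel_integrable bdd_borel_intros assms)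
  then show ?thesis by (simp add: norm_mult power2_eq_square)
qed

text \<open>The usual proof: the square of the distance from \<open>h\<close> to its partial Fourier sum over \<open>U\<close> is
\<open>\<integral>|h|\<^sup>2 - \<Sum>\<^bsub>u \<in> U\<^esub> |c u|\<^sup>2\<close>, and it is nonnegative.\<close>
lemma fourier_coeff_Bessel:
  assumes h: "bdd_borel h"
  shows "l2 (fourier_coeff h)" and "l2norm (fourier_coeff h) \<le> torus_norm h"
proof -
  define N where "N = (LINT t|torus. (cmod (h t))\<^sup>2)"
  have "L2_set (\<lambda>u. cmod (fourier_coeff h u)) U \<le> torus_norm h" if U: "finite U" for U
  proof -
    let ?c = "fourier_coeff h"
    define p where "p t = (\<Sum>u\<in>U. ?c u * cis (of_int u * t))" for t
    define S where "S = (\<Sum>u\<in>U. (cmod (?c u))\<^sup>2)"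
    have 1: "has_bochner_integral torus (\<lambda>t. complex_of_real ((cmod (h t))\<^sup>2)) (of_real N)"
      unfolding N_def by (intro has_bochner_integral_of_real has_bochner_integral_integrable
          bdd_borel_square_integrable h)
    have c: "has_bochner_integral torus (\<lambda>t. h t * cis (- of_int u * t)) (?c u)" for u
      unfolding fourier_coeff_def
        by (intro has_bochner_integral_integrable fourier_coeff_integrable h)
    have e: "has_bochner_integral torus (\<lambda>t. cis (of_int (u - v) * t)) (if u - v = 0 then 1 else 0)" for u v
      using has_bochner_integral_integrable[OF bdd_borel_integrable[OF bdd_borel_cis[of "of_int (u - v)"]]]
      by (simp add: integral_cis del: of_int_diff)
    have 2: "has_bochner_integral torus
        (\<lambda>t. \<Sum>u\<in>U. cnj (?c u) * (h t * cis (- of_int u * t))) (\<Sum>u\<in>U. cnj (?c u) * ?c u)"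
      by (intro has_bochner_integral_sum has_bochner_integral_mult_right c)
    have 3: "has_bochner_integral torus
        (\<lambda>t. \<Sum>u\<in>U. ?c u * cnj (h t * cis (- of_int u * t))) (\<Sum>u\<in>U. ?c u * cnj (?c u))"
      by (intro has_bochner_integral_sum has_bochner_integral_mult_right has_bochner_integral_cnj c)
    have 4: "has_bochner_integral torus
        (\<lambda>t. \<Sum>u\<in>U. \<Sum>v\<in>U. ?c u * cnj (?c v) * cis (of_int (u - v) * t))
        (\<Sum>u\<in>U. \<Sum>v\<in>U. ?c u * cnj (?c v) * (if u - v = 0 then 1 else 0))"
      by (intro has_bochner_integral_sum has_bochner_integral_mult_right e)
    have "has_bochner_integral torus (\<lambda>t. complex_of_real ((cmod (h t - p t))\<^sup>2))
       (of_real N - (\<Sum>u\<in>U. cnj (?c u) * ?c u) - (\<Sum>u\<in>U. ?c u * cnj (?c u))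
         + (\<Sum>u\<in>U. \<Sum>v\<in>U. ?c u * cnj (?c v) * (if u - v = 0 then 1 else 0)))"
    proof (rule has_bochner_integral_cong[THEN iffD1, OF refl _ refl,
          OF _ has_bochner_integral_add[OF has_bochner_integral_diff[OF
            has_bochner_integral_diff[OF 1 2] 3] 4]])
      fix t
      have pp: "p t * cnj (p t) = (\<Sum>u\<in>U. \<Sum>v\<in>U. ?c u * cnj (?c v) * cis (of_int (u - v) * t))"
        unfolding p_def cnj_sum sum_product
        by (intro sum.cong refl) (simp add: cis_cnj right_diff_distrib mult_ac cis_mult)
      have hp: "h t * cnj (p t) = (\<Sum>u\<in>U. cnj (?c u) * (h t * cis (- of_int u * t)))"
        unfolding p_def cnj_sum sum_distrib_left
        by (intro sum.cong refl) (simp add: cis_cnj algebra_simps)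
      have ph: "p t * cnj (h t) = (\<Sum>u\<in>U. ?c u * cnj (h t * cis (- of_int u * t)))"
        unfolding p_def cnj_sum sum_distrib_right
        by (intro sum.cong refl) (simp add: cis_cnj algebra_simps)
      show "complex_of_real ((cmod (h t))\<^sup>2) - (\<Sum>u\<in>U. cnj (?c u) * (h t * cis (- of_int u * t)))
          - (\<Sum>u\<in>U. ?c u * cnj (h t * cis (- of_int u * t)))
          + (\<Sum>u\<in>U. \<Sum>v\<in>U. ?c u * cnj (?c v) * cis (of_int (u - v) * t))
          = complex_of_real ((cmod (h t - p t))\<^sup>2)"
        unfolding complex_norm_square hp[symmetric] ph[symmetric] pp[symmetric]
        by (simp add: algebra_simps)
    qed
    moreover have "(\<Sum>u\<in>U. \<Sum>v\<in>U. ?c u * cnj (?c v) * (if u - v = 0 then 1 else 0)) = of_real S"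
    proof -
      have "(\<Sum>v\<in>U. ?c u * cnj (?c v) * (if u - v = 0 then 1 else 0)) = ?c u * cnj (?c u)"
        if "u \<in> U" for u
        using sum.delta[OF U, of u "\<lambda>v. ?c u * cnj (?c v)"] that
        by (simp add: if_distrib eq_commute[of u] cong: if_cong)
      then show ?thesis by (simp add: S_def complex_norm_square[symmetric])
    qed
    moreover have "(\<Sum>u\<in>U. ?c u * cnj (?c u)) = of_real S" "(\<Sum>u\<in>U. cnj (?c u) * ?c u) = of_real S"
      by (simp_all add: S_def complex_norm_square[symmetric] mult.commute)
    ultimately have "has_bochner_integral torus (\<lambda>t. complex_of_real ((cmod (h t - p t))\<^sup>2))
       (of_real (N - S))"
      by (simp add: algebra_simps)
    then have "(LINT t|torus. complex_of_real ((cmod (h t - p t))\<^sup>2)) = of_real (N - S)"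
      by (rule has_bochner_integral_integral_eq)
    then have "(LINT t|torus. (cmod (h t - p t))\<^sup>2) = N - S"
      using integral_complex_of_real of_real_eq_iff by metis
    moreover have "(LINT t|torus. (cmod (h t - p t))\<^sup>2) \<ge> 0"
      by (intro Bochner_Integration.integral_nonneg) simp
    ultimately have "S \<le> N" by linarith
    then show ?thesis
      unfolding L2_set_def torus_norm_def N_def[symmetric] S_def by (rule real_sqrt_le_mono)
  qed
  from l2_bounded_L2_set[of "fourier_coeff h", OF this] show "l2 (fourier_coeff h)" "l2norm (fourier_coeff h) \<le> torus_norm h"
    by auto
qed

section \<open>The spectral pairing\<close>

text \<open>Formally \<open>(1/2\<pi>) \<integral> h(t) \<phi>(t) dt\<close> with \<open>\<phi>(t) = \<Sum>\<^sub>u f u e\<^sup>-\<^sup>i\<^sup>u\<^sup>t\<close>. Defining it through the coefficients of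
\<open>h\<close> gives a meaning to the statement that \<open>\<phi>\<close> vanishes on a set, without constructing \<open>\<phi>\<close>.\<close>
definition pairing :: "(int \<Rightarrow> complex) \<Rightarrow> (real \<Rightarrow> complex) \<Rightarrow> complex" where
  "pairing f h = (\<Sum>\<^sub>\<infinity>u. f u * fourier_coeff h u)"

lemma pairing_summable: "l2 f \<Longrightarrow> bdd_borel h \<Longrightarrow> (\<lambda>u. f u * fourier_coeff h u) summable_on UNIV"
  by (intro l2_Cauchy_Schwarz fourier_coeff_Bessel)

lemma pairing_add:
  assumes "l2 f" "bdd_borel h" "bdd_borel k"
  shows "pairing f (\<lambda>t. h t + k t) = pairing f h + pairing f k"
  unfolding pairing_def
  by (simp add: fourier_coeff_add assms distrib_left infsum_add pairing_summable)

lemma pairing_scale: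
  assumes "l2 f" "bdd_borel h"
  shows "pairing f (\<lambda>t. c * h t) = c * pairing f h"
proof -
  have "pairing f (\<lambda>t. c * h t) = (\<Sum>\<^sub>\<infinity>u. c * (f u * fourier_coeff h u))"
    unfolding pairing_def fourier_coeff_scale by (simp add: mult_ac)
  also have "\<dots> = c * pairing f h"
    unfolding pairing_def by (rule infsum_cmult_right) (rule pairing_summable[OF assms])
  finally show ?thesis .
qed

lemma pairing_diff:
  assumes "l2 f" "bdd_borel h" "bdd_borel k"
  shows "pairing f (\<lambda>t. h t - k t) = pairing f h - pairing f k"
  using pairing_add[OF assms(1,2) bdd_borel_mult[OF bdd_borel_const assms(3), of "-1"]]
    pairing_scale[OF assms(1,3), of "-1"] by simp

lemma pairing_cis: "pairing f (\<lambda>t. cis (of_int m * t)) = f m"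
proof -
  have "pairing f (\<lambda>t. cis (of_int m * t)) = (\<Sum>\<^sub>\<infinity>u. if u = m then f u else 0)"
    unfolding pairing_def fourier_coeff_cis by (intro infsum_cong) simp
  also have "\<dots> = (\<Sum>\<^sub>\<infinity>u\<in>{m}. if u = m then f u else 0)"
    by (intro infsum_cong_neutral) auto
  finally show ?thesis by simp
qed

lemma pairing_bound:
  assumes "l2 f" "bdd_borel h"
  shows "cmod (pairing f h) \<le> l2norm f * torus_norm h"
proof -
  have "cmod (pairing f h) \<le> l2norm f * l2norm (fourier_coeff h)"
    unfolding pairing_def by (intro l2_Cauchy_Schwarz fourier_coeff_Bessel assms)
  also have "\<dots> \<le> l2norm f * torus_norm h"
    by (intro mult_left_mono fourier_coeff_Bessel assms) simp
  finally show ?thesis .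
qed

lemma torus_norm_bound:
  assumes "h \<in> borel_measurable borel" "\<And>t. cmod (h t) \<le> B"
  shows "torus_norm h \<le> B"
proof -
  have B: "0 \<le> B" using assms(2)[of 0] norm_ge_zero order_trans by blast
  have bm: "bdd_borel h" using assms by (auto simp: bdd_borel_def)
  have "(LINT t|torus. (cmod (h t))\<^sup>2) \<le> (LINT t|torus. B\<^sup>2)"
    by (intro integral_mono bdd_borel_square_integrable bm) (auto intro!: power_mono assms)
  then show ?thesis using B unfolding torus_norm_def by (simp add: real_le_lsqrt)
qed

text \<open>Bounded pointwise convergence implies convergence in \<open>L\<^sup>2\<close> of the torus, and the pairing is
\<open>L\<^sup>2\<close>-continuous by \<open>pairing_bound\<close>. This is how indicators of intervals are reached from smooth
functions.\<close>
lemma pairing_tendsto: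
  assumes f: "l2 f" and hk: "\<And>k. h k \<in> borel_measurable borel" and lim: "\<And>t. (\<lambda>k. h k t) \<longlonglongrightarrow> g t"
    and bd: "\<And>k t. cmod (h k t) \<le> B"
  shows "(\<lambda>k. pairing f (h k)) \<longlonglongrightarrow> pairing f g"
proof -
  have g: "g \<in> borel_measurable borel"
    by (rule borel_measurable_LIMSEQ_metric[OF hk lim])
  have gB: "cmod (g t) \<le> B" for t
    by (rule LIMSEQ_le_const2[OF tendsto_norm[OF lim]]) (use bd in auto)
  have bm: "bdd_borel (h k)" "bdd_borel g" for k using hk bd g gB by (auto simp: bdd_borel_def)
  have "(\<lambda>k. LINT t|torus. (cmod (h k t - g t))\<^sup>2) \<longlonglongrightarrow> (LINT t|torus. (0::real))"
  proof (rule integral_dominated_convergence[where w = "\<lambda>t. (2 * B)\<^sup>2"])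
    have "(\<lambda>k. (cmod (h k t - g t))\<^sup>2) \<longlonglongrightarrow> (cmod (g t - g t))\<^sup>2" for t
      by (intro tendsto_intros lim)
    then show "AE t in torus. (\<lambda>k. (cmod (h k t - g t))\<^sup>2) \<longlonglongrightarrow> 0" by simp
    have "cmod (h k t - g t) \<le> 2 * B" for k t
      using norm_triangle_ineq4[of "h k t" "g t"] bd[of k t] gB[of t] by linarith
    then show "AE t in torus. norm ((cmod (h k t - g t))\<^sup>2) \<le> (2 * B)\<^sup>2" for k
      by (intro AE_I2) (simp only: real_norm_def abs_power2, intro power_mono, auto)
    show "(\<lambda>t. (cmod (h k t - g t))\<^sup>2) \<in> borel_measurable torus" for k
      by (intro borel_measurable_integrable bdd_borel_square_integrable bdd_borel_diff bm)
  qed simp_all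
  from tendsto_mult_left[OF tendsto_real_sqrt[OF this], of "l2norm f"]
  have lim0: "(\<lambda>k. l2norm f * torus_norm (\<lambda>t. h k t - g t)) \<longlonglongrightarrow> 0"
    by (simp add: torus_norm_def)
  have "cmod (pairing f (h k) - pairing f g) \<le> l2norm f * torus_norm (\<lambda>t. h k t - g t)" for k
    using pairing_bound[OF f bdd_borel_diff[OF bm(1)[of k] bm(2)]] pairing_diff[OF f bm(1)[of k] bm(2)]
    by simp
  then have "(\<lambda>k. pairing f (h k) - pairing f g) \<longlonglongrightarrow> 0"
    by (intro Lim_null_comparison[OF _ lim0] always_eventually allI)
  then show ?thesis by (rule LIM_zero_cancel)
qed

section \<open>Absolutely summable Fourier coefficients\<close>

lemma l2_inverse_linear: "l2 (\<lambda>u::int. 1 / (1 + \<i> * of_int u))"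
proof -
  let ?w = "\<lambda>u::int. 1 / (1 + (of_int u)\<^sup>2 :: real)"
  have "summable (\<lambda>n. 1 / (1 + (real n)\<^sup>2))"
  proof (rule summable_comparison_test')
    show "summable (\<lambda>n. inverse ((real n)\<^sup>2))" by (rule inverse_power_summable) simp
    show "norm (1 / (1 + (real n)\<^sup>2)) \<le> inverse ((real n)\<^sup>2)" if "n \<ge> 1" for n
      using that by (auto simp: inverse_eq_divide
        intro!: divide_left_mono mult_pos_pos add_pos_nonneg)
  qed
  then have nat: "(\<lambda>n. 1 / (1 + (real n)\<^sup>2)) summable_on UNIV"
    by (subst summable_on_UNIV_nonneg_real_iff) auto
  have "?w summable_on range int"
    using nat by (subst summable_on_reindex) (auto simp: o_def)
  moreover have "?w summable_on range (\<lambda>n. - int n)"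
    using nat by (subst summable_on_reindex) (auto simp: o_def inj_on_def)
  ultimately have "?w summable_on (range int \<union> range (\<lambda>n. - int n))"
    by (rule summable_on_union)
  also have "range int \<union> range (\<lambda>n. - int n) = UNIV"
    by (metis (no_types, lifting) UNIV_eq_I UnCI int_cases2 rangeI)
  finally show ?thesis
    unfolding l2_def by (simp add: norm_divide cmod_power2 power_divide)
qed

text \<open>Vanishing at the ends makes the integration by parts in \<open>fourier_coeff_deriv\<close> free of boundary
terms, even though the extension of \<open>g\<close> by zero need not be differentiable at \<open>a\<close> and \<open>b\<close>.\<close>
definition C1_vanishing :: "real \<Rightarrow> real \<Rightarrow> (real \<Rightarrow> complex) \<Rightarrow> (real \<Rightarrow> complex) \<Rightarrow> bool" where
  "C1_vanishing a b g g' \<longleftrightarrow> (\<forall>t\<in>{a..b}. (g has_vector_derivative g' t) (at t within {a..b})) \<and>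
     continuous_on {a..b} g' \<and> g a = 0 \<and> g b = 0"

abbreviation cut_to :: "real \<Rightarrow> real \<Rightarrow> (real \<Rightarrow> complex) \<Rightarrow> real \<Rightarrow> complex" where
  "cut_to a b g \<equiv> (\<lambda>t. indicator {a..b} t *\<^sub>R g t)"

lemma continuous_on_interval_bounded:
  fixes g :: "real \<Rightarrow> complex"
  assumes "continuous_on {a..b} g"
  obtains M where "0 \<le> M" "\<And>t. t \<in> {a..b} \<Longrightarrow> cmod (g t) \<le> M"
proof -
  have "bounded (g ` {a..b})" by (intro compact_imp_bounded compact_continuous_image assms) simp
  then obtain M where "\<forall>x\<in>g ` {a..b}. cmod x \<le> M" by (auto simp: bounded_iff)
  then show ?thesis using that[of "max 0 M"] by (simp add: le_max_iff_disj)
qed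

lemma bdd_borel_cut_to:
  assumes "continuous_on {a..b} g" shows "bdd_borel (cut_to a b g)"
proof -
  obtain M where "0 \<le> M" "\<And>t. t \<in> {a..b} \<Longrightarrow> cmod (g t) \<le> M"
    using continuous_on_interval_bounded[OF assms] by blast
  then have "cmod (cut_to a b g t) \<le> M" for t by (auto simp: indicator_def)
  then show ?thesis
    using borel_measurable_continuous_on_indicator[OF _ assms] unfolding bdd_borel_def by auto
qed

lemma C1_vanishing_continuous: "C1_vanishing a b g g' \<Longrightarrow> continuous_on {a..b} g"
  unfolding C1_vanishing_def by (auto intro: continuous_on_vector_derivative)

lemma fourier_coeff_deriv:
  assumes ab: "a \<le> b" "{a..b} \<subseteq> {-pi..<pi}" and g: "C1_vanishing a b g g'"
  shows "fourier_coeff (cut_to a b g') u = \<i> * of_int u * fourier_coeff (cut_to a b g) u"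
proof -
  let ?e = "\<lambda>t. cis (- of_int u * t)"
  let ?d = "\<lambda>t. g t * (\<i> * of_real (- of_int u) * ?e t) + g' t * ?e t"
  have cg: "continuous_on {a..b} g" by (rule C1_vanishing_continuous[OF g])
  have cg': "continuous_on {a..b} g'" using g by (simp add: C1_vanishing_def)
  have cd: "continuous_on {a..b} ?d" by (intro continuous_intros cg cg')
  have "(LINT t|torus. cut_to a b ?d t) = (1 / (2 * pi)) *\<^sub>R (LINT t|lborel. cut_to a b ?d t)"
  proof -
    have "(LINT t:{-pi..<pi}|lborel. cut_to a b ?d t) = (LINT t|lborel. cut_to a b ?d t)"
      unfolding set_lebesgue_integral_def
      by (intro Bochner_Integration.integral_cong refl) (use ab in \<open>auto simp: indicator_def\<close>)
    then show ?thesis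
      using integral_torus[OF bdd_borel_measurable[OF bdd_borel_cut_to[OF cd]]] by simp
  qed
  also have "(LINT t|lborel. cut_to a b ?d t) = g b * ?e b - g a * ?e a"
  proof (rule integral_FTC_Icc[OF ab(1) _ cd])
    fix t assume "a \<le> t" "t \<le> b"
    then have "(g has_vector_derivative g' t) (at t within {a..b})"
      using g by (simp add: C1_vanishing_def)
    then show "((\<lambda>t. g t * ?e t) has_vector_derivative ?d t) (at t within {a..b})"
      by (rule has_vector_derivative_mult[OF _ has_vector_derivative_cis_mult])
  qed
  also have "\<dots> = 0" using g by (simp add: C1_vanishing_def)
  also have "(LINT t|torus. cut_to a b ?d t) =
      (LINT t|torus. - \<i> * of_int u * (cut_to a b g t * ?e t) + cut_to a b g' t * ?e t)"
    by (intro Bochner_Integration.integral_cong) (auto simp: indicator_def)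
  also have "\<dots> = - \<i> * of_int u * fourier_coeff (cut_to a b g) u + fourier_coeff (cut_to a b g') u"
    unfolding fourier_coeff_def integral_mult_right_zero[symmetric]
    by (intro Bochner_Integration.integral_add integrable_mult_right fourier_coeff_integrable bdd_borel_cut_to cg cg')
  finally show ?thesis by (simp add: algebra_simps)
qed

definition bernstein_const :: real where "bernstein_const = l2norm (\<lambda>u::int. 1 / (1 + \<i> * of_int u))"

text \<open>The coefficient of \<open>g + g'\<close> at \<open>u\<close> is \<open>1 + \<i>u\<close> times that of \<open>g\<close>. So the coefficients of \<open>g\<close> are a
product of two square summable sequences: \<open>1 / (1 + \<i>u)\<close>, and the coefficients of \<open>g + g'\<close>, controlled
by Bessel's inequality.\<close>
lemma fourier_coeff_abs_summable:
  assumes ab: "a \<le> b" "{a..b} \<subseteq> {-pi..<pi}" and g: "C1_vanishing a b g g'"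
    and M: "\<And>t. t \<in> {a..b} \<Longrightarrow> cmod (g t) \<le> M" "\<And>t. t \<in> {a..b} \<Longrightarrow> cmod (g' t) \<le> M'"
  shows "(\<lambda>u. cmod (fourier_coeff (cut_to a b g) u)) summable_on UNIV"
    and "(\<Sum>\<^sub>\<infinity>u. cmod (fourier_coeff (cut_to a b g) u)) \<le> bernstein_const * (M + M')"
proof -
  have cg: "continuous_on {a..b} g" by (rule C1_vanishing_continuous[OF g])
  have cg': "continuous_on {a..b} g'" using g by (simp add: C1_vanishing_def)
  have bm: "bdd_borel (cut_to a b g)" "bdd_borel (cut_to a b g')"
    by (intro bdd_borel_cut_to cg cg')+
  let ?h = "\<lambda>t. cut_to a b g t + cut_to a b g' t"
  have h: "bdd_borel ?h" by (intro bdd_borel_add bm)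
  have "fourier_coeff ?h u = (1 + \<i> * of_int u) * fourier_coeff (cut_to a b g) u" for u
    by (simp add: fourier_coeff_add bm fourier_coeff_deriv[OF ab g] algebra_simps)
  moreover have "1 + \<i> * of_int u \<noteq> 0" for u
    by (auto simp: complex_eq_iff)
  ultimately have eq: "1 / (1 + \<i> * of_int u) * fourier_coeff ?h u = fourier_coeff (cut_to a b g) u" for u
    by (simp add: field_simps)
  note CS = l2_Cauchy_Schwarz[OF l2_inverse_linear fourier_coeff_Bessel(1)[OF h], unfolded eq]
  show "(\<lambda>u. cmod (fourier_coeff (cut_to a b g) u)) summable_on UNIV" by (rule CS(1))
  have "M \<ge> 0" "M' \<ge> 0" using M[of a] ab by (auto intro: order_trans[OF norm_ge_zero])
  then have "cmod (?h t) \<le> M + M'" for t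
    using M[of t] by (auto simp: indicator_def intro!: order_trans[OF norm_triangle_ineq])
  then have "l2norm (fourier_coeff ?h) \<le> M + M'"
    by (intro order_trans[OF fourier_coeff_Bessel(2)[OF h]] torus_norm_bound) (use h bdd_borel_def in auto)
  then have "bernstein_const * l2norm (fourier_coeff ?h) \<le> bernstein_const * (M + M')"
    by (intro mult_left_mono) (simp_all add: bernstein_const_def)
  then show "(\<Sum>\<^sub>\<infinity>u. cmod (fourier_coeff (cut_to a b g) u)) \<le> bernstein_const * (M + M')"
    using CS(2) by (simp add: bernstein_const_def)
qed

section \<open>Growth restricts the spectrum\<close>

lemma has_vector_derivative_quotient:
  fixes f g :: "real \<Rightarrow> complex"
  assumes "(f has_vector_derivative f') (at t within S)" "(g has_vector_derivative g') (at t within S)"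
    and "g t \<noteq> 0"
  shows "((\<lambda>t. f t / g t) has_vector_derivative ((f' * g t - f t * g') / (g t * g t))) (at t within S)"
proof -
  have "((\<lambda>t. f t / g t) has_derivative (\<lambda>h. (h *\<^sub>R f' * g t - f t * (h *\<^sub>R g')) / (g t * g t))) (at t within S)"
    using assms unfolding has_vector_derivative_def by (rule has_derivative_divide')
  also have "(\<lambda>h. (h *\<^sub>R f' * g t - f t * (h *\<^sub>R g')) / (g t * g t))
      = (\<lambda>h. h *\<^sub>R ((f' * g t - f t * g') / (g t * g t)))"
    unfolding mult_scaleR_left mult_scaleR_right scaleR_diff_right[symmetric] divide_inverse ..
  finally show ?thesis unfolding has_vector_derivative_def .
qed

lemma has_vector_derivative_pow:
  fixes f :: "real \<Rightarrow> complex"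
  assumes "(f has_vector_derivative f') (at t within S)"
  shows "((\<lambda>t. f t ^ n) has_vector_derivative (of_nat n * f t ^ (n - 1) * f')) (at t within S)"
proof -
  have "((\<lambda>t. f t ^ n) has_derivative (\<lambda>h. of_nat n * (h *\<^sub>R f') * f t ^ (n - 1))) (at t within S)"
    using assms unfolding has_vector_derivative_def by (rule has_derivative_power)
  also have "(\<lambda>h. of_nat n * (h *\<^sub>R f') * f t ^ (n - 1)) = (\<lambda>h. h *\<^sub>R (of_nat n * f t ^ (n - 1) * f'))"
    by (simp add: fun_eq_iff mult_ac)
  finally show ?thesis unfolding has_vector_derivative_def .
qed

lemma C1_vanishing_mult:
  assumes "\<And>t. t \<in> {a..b} \<Longrightarrow> (k has_vector_derivative k' t) (at t within {a..b})" "continuous_on {a..b} k'"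
    and g: "C1_vanishing a b g g'"
  shows "C1_vanishing a b (\<lambda>t. k t * g t) (\<lambda>t. k t * g' t + k' t * g t)"
proof -
  have "continuous_on {a..b} k"
    using assms(1) by (rule continuous_on_vector_derivative)
  with assms C1_vanishing_continuous[OF g] show ?thesis
    unfolding C1_vanishing_def by (auto intro!: has_vector_derivative_mult continuous_intros)
qed

text \<open>Summation by parts moves the shift from the Fourier coefficients to the bounded sequence.\<close>
lemma infsum_shift:
  fixes f W :: "int \<Rightarrow> complex"
  assumes W: "(\<lambda>u. cmod (W u)) summable_on UNIV" and f: "\<And>u. cmod (f u) \<le> c"
  shows "(\<Sum>\<^sub>\<infinity>u. f u * (A0 * W u + A1 * W (u - 1))) = (\<Sum>\<^sub>\<infinity>u. (A0 * f u + A1 * f (u + 1)) * W u)"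
proof -
  have s: "(\<lambda>u. k u * W u) summable_on UNIV" if "\<And>u. cmod (k u) \<le> d" for k d
  proof (rule abs_summable_summable, rule summable_on_comparison_test)
    show "(\<lambda>u. d * cmod (W u)) summable_on UNIV" by (rule summable_on_cmult_right[OF W])
  qed (auto simp: norm_mult intro!: mult_right_mono that)
  have s0: "(\<lambda>u. A0 * (f u * W u)) summable_on UNIV"
    by (intro summable_on_cmult_right s[of _ c] f)
  have s1: "(\<lambda>u. A1 * (f (u + 1) * W u)) summable_on UNIV"
    by (intro summable_on_cmult_right s[of _ c] f)
  have bij: "bij (\<lambda>u::int. u - 1)" by (rule bij_betw_byWitness[where f' = "\<lambda>u. u + 1"]) auto
  have s1': "(\<lambda>u. A1 * (f u * W (u - 1))) summable_on UNIV"
    using s1 summable_on_reindex_bij_betw[OF bij, of "\<lambda>u. A1 * (f (u + 1) * W u)"] by simp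
  have "(\<Sum>\<^sub>\<infinity>u. f u * (A0 * W u + A1 * W (u - 1)))
      = (\<Sum>\<^sub>\<infinity>u. A0 * (f u * W u) + A1 * (f u * W (u - 1)))"
    by (simp add: algebra_simps)
  also have "\<dots> = (\<Sum>\<^sub>\<infinity>u. A0 * (f u * W u)) + (\<Sum>\<^sub>\<infinity>u. A1 * (f u * W (u - 1)))"
    by (rule infsum_add[OF s0 s1'])
  also have "(\<Sum>\<^sub>\<infinity>u. A1 * (f u * W (u - 1))) = (\<Sum>\<^sub>\<infinity>u. A1 * (f (u + 1) * W u))"
    using infsum_reindex_bij_betw[OF bij, of "\<lambda>u. A1 * (f (u + 1) * W u)"] by simp
  also have "(\<Sum>\<^sub>\<infinity>u. A0 * (f u * W u)) + \<dots> = (\<Sum>\<^sub>\<infinity>u. A0 * (f u * W u) + A1 * (f (u + 1) * W u))"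
    by (rule infsum_add[OF s0 s1, symmetric])
  finally show ?thesis by (simp add: algebra_simps)
qed

lemma fourier_coeff_linear_mult:
  assumes "continuous_on {a..b} w"
  shows "fourier_coeff (cut_to a b (\<lambda>t. (A0 + A1 * cis t) * w t)) u =
    A0 * fourier_coeff (cut_to a b w) u + A1 * fourier_coeff (cut_to a b w) (u - 1)"
proof -
  have bw: "bdd_borel (cut_to a b w)" by (rule bdd_borel_cut_to[OF assms])
  have "cut_to a b (\<lambda>t. (A0 + A1 * cis t) * w t) =
    (\<lambda>t. A0 * cut_to a b w t + A1 * (cis (of_int 1 * t) * cut_to a b w t))"
    by (auto simp: fun_eq_iff algebra_simps indicator_def)
  then show ?thesis
    by (simp only: fourier_coeff_add fourier_coeff_scale fourier_coeff_cis_mult bw bdd_borel_intros)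
qed

text \<open>On the Fourier side the recursion reads \<open>f (n+1) = (B/A) f n\<close> with \<open>A = A0 + A1 e\<^sup>i\<^sup>t\<close> and
\<open>B = B0 + B1 e\<^sup>i\<^sup>t\<close>. Where \<open>|B/A| > R\<close> this forces growth faster than \<open>R\<^sup>n\<close>, so \<open>f 0\<close> cannot have spectrum
there. Leaving the four constants free lets one statement serve both directions of \<open>n\<close>, where
\<open>A\<close> and \<open>B\<close> change places.\<close>
lemma growth_annihilates:
  fixes f :: "nat \<Rightarrow> int \<Rightarrow> complex"
  assumes rec: "\<And>n u. A0 * f (Suc n) u + A1 * f (Suc n) (u + 1) = B0 * f n u + B1 * f n (u + 1)"
    and bd: "\<And>n u. cmod (f n u) \<le> c * R ^ n" and R: "0 < R"
    and ab: "a \<le> b" "{a..b} \<subseteq> {-pi..<pi}"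
    and small: "\<And>t. t \<in> {a..b} \<Longrightarrow> cmod (A0 + A1 * cis t) * R < cmod (B0 + B1 * cis t)"
    and g: "C1_vanishing a b g g'"
  shows "(\<Sum>\<^sub>\<infinity>u. f 0 u * fourier_coeff (cut_to a b g) u) = 0"
proof -
  let ?A = "\<lambda>t. A0 + A1 * cis t" and ?B = "\<lambda>t. B0 + B1 * cis t"
  let ?A' = "\<lambda>t. A1 * (\<i> * cis t)" and ?B' = "\<lambda>t. B1 * (\<i> * cis t)"
  have c0: "0 \<le> c" using order_trans[OF norm_ge_zero bd[of 0 0]] by simp
  have B: "?B t \<noteq> 0" if "t \<in> {a..b}" for t
    using small[OF that] mult_nonneg_nonneg[OF norm_ge_zero[of "?A t"] less_imp_le[OF R]] by auto
  have lin: "((\<lambda>t. x + y * cis t) has_vector_derivative y * (\<i> * cis t)) (at t within S)" for x y t S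
    using has_vector_derivative_cis_mult[of 1 t S] by (auto intro!: derivative_eq_intros)
  define \<mu> where "\<mu> t = ?A t / ?B t" for t
  define \<mu>' where "\<mu>' t = (?A' t * ?B t - ?A t * ?B' t) / (?B t * ?B t)" for t
  have d\<mu>: "(\<mu> has_vector_derivative \<mu>' t) (at t within {a..b})" if "t \<in> {a..b}" for t
    unfolding \<mu>_def \<mu>'_def by (intro has_vector_derivative_quotient lin B that)
  have c\<mu>: "continuous_on {a..b} \<mu>" "continuous_on {a..b} \<mu>'"
    unfolding \<mu>_def \<mu>'_def by (intro continuous_intros; use B in auto)+
  define \<nu>' where "\<nu>' t = (0 * ?B t - 1 * ?B' t) / (?B t * ?B t)" for t
  have d\<nu>: "((\<lambda>t. 1 / ?B t) has_vector_derivative \<nu>' t) (at t within {a..b})" if "t \<in> {a..b}" for t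
    unfolding \<nu>'_def by (intro has_vector_derivative_quotient lin B that has_vector_derivative_const)
  have c\<nu>: "continuous_on {a..b} \<nu>'"
    unfolding \<nu>'_def by (intro continuous_intros; use B in auto)
  \<comment> \<open>Pairing row \<open>n\<close> with \<open>G n\<close> gives a value that is independent of \<open>n\<close>.\<close>
  define G where "G n t = \<mu> t ^ n * g t" for n t
  define G' where "G' n t = \<mu> t ^ n * g' t + (of_nat n * \<mu> t ^ (n - 1) * \<mu>' t) * g t" for n t
  have bG: "C1_vanishing a b (G n) (G' n)" for n
    unfolding G_def[abs_def] G'_def[abs_def]
    by (intro C1_vanishing_mult has_vector_derivative_pow d\<mu> g continuous_intros c\<mu>)
  define X where "X n = fourier_coeff (cut_to a b (G n))" for n

  \<comment> \<open>Strict inequality on a compact interval leaves room for a geometric factor that absorbs the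
    factor \<open>n\<close> produced by differentiating \<open>\<mu>\<^sup>n\<close>.\<close>
  obtain q where q: "0 < q" "R * q < 1" "\<And>t. t \<in> {a..b} \<Longrightarrow> cmod (\<mu> t) \<le> q"
  proof -
    have "continuous_on {a..b} (\<lambda>t. cmod (\<mu> t))" by (intro continuous_intros c\<mu>)
    from continuous_attains_sup[OF _ _ this] ab
    obtain s where s: "s \<in> {a..b}" "\<And>t. t \<in> {a..b} \<Longrightarrow> cmod (\<mu> t) \<le> cmod (\<mu> s)" by auto
    have "cmod (\<mu> s) < 1 / R"
      using small[OF s(1)] B[OF s(1)] R by (simp add: \<mu>_def norm_divide field_simps)
    then obtain q where q: "cmod (\<mu> s) < q" "q < 1 / R" using dense by blast
    have "0 < q" using q(1) norm_ge_zero[of "\<mu> s"] by linarith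
    moreover have "R * q < 1" using q(2) R by (simp add: field_simps)
    ultimately show ?thesis using that[of q] s(2) q(1) by fastforce
  qed

  obtain Mg where Mg: "0 \<le> Mg" "\<And>t. t \<in> {a..b} \<Longrightarrow> cmod (g t) \<le> Mg"
    using continuous_on_interval_bounded[OF C1_vanishing_continuous[OF g]] by blast
  obtain Mg' where Mg': "0 \<le> Mg'" "\<And>t. t \<in> {a..b} \<Longrightarrow> cmod (g' t) \<le> Mg'"
    using continuous_on_interval_bounded g unfolding C1_vanishing_def by blast
  obtain K where K: "0 \<le> K" "\<And>t. t \<in> {a..b} \<Longrightarrow> cmod (\<mu>' t) \<le> K"
    using continuous_on_interval_bounded[OF c\<mu>(2)] by blast
  have pow: "cmod (\<mu> t) ^ n \<le> q ^ n" if "t \<in> {a..b}" for n t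
    by (intro power_mono q that) simp
  have MG: "cmod (G n t) \<le> q ^ n * Mg" if "t \<in> {a..b}" for n t
    unfolding G_def norm_mult norm_power using q(1) by (intro mult_mono pow Mg that) auto
  have MG': "cmod (G' n t) \<le> q ^ n * Mg' + of_nat n * q ^ (n - 1) * K * Mg" if "t \<in> {a..b}" for n t
  proof -
    have "cmod (\<mu> t ^ n * g' t) \<le> q ^ n * Mg'"
      unfolding norm_mult norm_power using q(1) by (intro mult_mono pow Mg' that) auto
    moreover have "cmod (of_nat n * \<mu> t ^ (n - 1) * \<mu>' t * g t) \<le> of_nat n * q ^ (n - 1) * K * Mg"
      unfolding norm_mult norm_power norm_of_nat using q(1) K(1)
      by (intro mult_mono pow K Mg that order_refl mult_nonneg_nonneg) auto
    ultimately show ?thesis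
      unfolding G'_def by (rule order_trans[OF norm_triangle_ineq add_mono])
  qed
  note XS = fourier_coeff_abs_summable[OF ab bG MG MG', folded X_def]

  have "(\<Sum>\<^sub>\<infinity>u. f (Suc n) u * X (Suc n) u) = (\<Sum>\<^sub>\<infinity>u. f n u * X n u)" for n
  proof -
    \<comment> \<open>With this \<open>w\<close> one has \<open>G (n + 1) = A w\<close> and \<open>G n = B w\<close>, so \<open>infsum_shift\<close> turns the two sums
      into the two sides of the recursion.\<close>
    define w where "w t = 1 / ?B t * G n t" for t
    have bw: "C1_vanishing a b w (\<lambda>t. 1 / ?B t * G' n t + \<nu>' t * G n t)"
      unfolding w_def by (intro C1_vanishing_mult d\<nu> c\<nu> bG)
    obtain M1 where M1: "\<And>t. t \<in> {a..b} \<Longrightarrow> cmod (w t) \<le> M1"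
      using continuous_on_interval_bounded[OF C1_vanishing_continuous[OF bw]] by blast
    obtain M2 where M2: "\<And>t. t \<in> {a..b} \<Longrightarrow> cmod (1 / ?B t * G' n t + \<nu>' t * G n t) \<le> M2"
      using continuous_on_interval_bounded bw unfolding C1_vanishing_def by blast
    define W where "W = fourier_coeff (cut_to a b w)"
    have W: "(\<lambda>u. cmod (W u)) summable_on UNIV"
      unfolding W_def by (rule fourier_coeff_abs_summable[OF ab bw M1 M2])
    have "cut_to a b (G (Suc n)) = cut_to a b (\<lambda>t. ?A t * w t)"
      using B by (auto simp: fun_eq_iff indicator_def G_def w_def \<mu>_def)
    then have X1: "X (Suc n) u = A0 * W u + A1 * W (u - 1)" for u
      unfolding X_def W_def using fourier_coeff_linear_mult[OF C1_vanishing_continuous[OF bw]] by simp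
    have "cut_to a b (G n) = cut_to a b (\<lambda>t. ?B t * w t)"
      using B by (auto simp: fun_eq_iff indicator_def w_def)
    then have X0: "X n u = B0 * W u + B1 * W (u - 1)" for u
      unfolding X_def W_def using fourier_coeff_linear_mult[OF C1_vanishing_continuous[OF bw]] by simp
    show ?thesis
      unfolding X0 X1 by (simp only: infsum_shift[OF W bd] rec)
  qed
  then have const: "(\<Sum>\<^sub>\<infinity>u. f n u * X n u) = (\<Sum>\<^sub>\<infinity>u. f 0 u * X 0 u)" for n
    by (induction n) auto

  have ring_eq: "c * P * (C * (Q * x + (Q * y + k * Q * i * K * x)))
      = c * C * ((x + y) * (P * Q) + K * x * i * (k * (P * Q)))" for P Q C x y k i :: real
    by (simp only: distrib_left distrib_right mult_ac)
  have bound: "cmod (\<Sum>\<^sub>\<infinity>u. f n u * X n u) \<le>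
      c * bernstein_const * ((Mg + Mg') * (R * q) ^ n + K * Mg / q * (of_nat n * (R * q) ^ n))" for n
  proof -
    have "cmod (\<Sum>\<^sub>\<infinity>u. f n u * X n u) \<le> (\<Sum>\<^sub>\<infinity>u. c * R ^ n * cmod (X n u))"
    proof (rule norm_infsum_le[OF has_sum_infsum has_sum_infsum])
      show le: "cmod (f n u * X n u) \<le> c * R ^ n * cmod (X n u)" for u
        unfolding norm_mult by (intro mult_right_mono bd) simp
      show s: "(\<lambda>u. c * R ^ n * cmod (X n u)) summable_on UNIV"
        by (intro summable_on_cmult_right XS)
      show "(\<lambda>u. f n u * X n u) summable_on UNIV"
        by (rule abs_summable_summable[OF summable_on_comparison_test[OF s le]]) simp
    qed
    also have "\<dots> = c * R ^ n * (\<Sum>\<^sub>\<infinity>u. cmod (X n u))"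
      by (intro infsum_cmult_right XS)
    also have "\<dots> \<le> c * R ^ n * (bernstein_const * (q ^ n * Mg + (q ^ n * Mg' + of_nat n * q ^ (n - 1) * K * Mg)))"
      using R c0 by (intro mult_left_mono XS) auto
    also have "of_nat n * q ^ (n - 1) = of_nat n * q ^ n * inverse q"
      using q(1) by (cases n) auto
    also have "c * R ^ n * (bernstein_const * (q ^ n * Mg + (q ^ n * Mg' + of_nat n * q ^ n * inverse q * K * Mg)))
        = c * bernstein_const * ((Mg + Mg') * (R * q) ^ n + K * Mg / q * (of_nat n * (R * q) ^ n))"
      unfolding power_mult_distrib divide_inverse by (rule ring_eq)
    finally show ?thesis .
  qed
  have "(\<lambda>n. (R * q) ^ n) \<longlonglongrightarrow> 0" "(\<lambda>n. of_nat n * (R * q) ^ n) \<longlonglongrightarrow> 0"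
    using q R by (auto intro!: LIMSEQ_power_zero powser_times_n_limit_0 simp: abs_mult)
  then have "(\<lambda>n. c * bernstein_const * ((Mg + Mg') * (R * q) ^ n + K * Mg / q * (of_nat n * (R * q) ^ n)))
      \<longlonglongrightarrow> c * bernstein_const * ((Mg + Mg') * 0 + K * Mg / q * 0)"
    by (intro tendsto_mult_left tendsto_add)
  then have lim0: "(\<lambda>n. c * bernstein_const * ((Mg + Mg') * (R * q) ^ n + K * Mg / q * (of_nat n * (R * q) ^ n))) \<longlonglongrightarrow> 0"
    by simp
  have "(\<lambda>n. \<Sum>\<^sub>\<infinity>u. f n u * X n u) \<longlonglongrightarrow> 0"
    by (rule Lim_null_comparison[OF always_eventually[OF allI[OF bound]] lim0])
  then have "(\<Sum>\<^sub>\<infinity>u. f 0 u * X 0 u) = 0"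
    unfolding ext[of "\<lambda>n. \<Sum>\<^sub>\<infinity>u. f n u * X n u" "\<lambda>_. \<Sum>\<^sub>\<infinity>u. f 0 u * X 0 u", OF const]
    by (simp only: LIMSEQ_const_iff)
  then show ?thesis by (simp add: X_def G_def)
qed

section \<open>The multiplier and the set \<open>D\<^sub>\<alpha>\<close>\<close>

definition multiplier :: "real \<Rightarrow> complex" where
  "multiplier t = (1 + \<i> * cis t) / (\<i> + cis t)"

definition growth_rate :: "real \<Rightarrow> real" where
  "growth_rate \<alpha> = cmod (discrete_exp (- \<alpha>) (0, 1))"

lemma discrete_exp_eq: "discrete_exp t (m, n) = cis (of_int m * t) * multiplier t powi n"
  by (simp add: discrete_exp_def multiplier_def cis_conv_exp mult_ac)

lemma cmod_multiplier_parts: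
  "(cmod (1 + \<i> * cis t))\<^sup>2 = 2 - 2 * sin t" "(cmod (\<i> + cis t))\<^sup>2 = 2 + 2 * sin t"
  using sin_cos_squared_add[of t] unfolding cmod_power2
    by (simp_all add: power2_eq_square algebra_simps)

lemma multiplier_real: "cnj (multiplier t) = multiplier t"
proof -
  have z: "cis t * cnj (cis t) = 1" by (simp add: cis_cnj cis_mult)
  show ?thesis
  proof (cases "\<i> + cis t = 0")
    case False
    then have "cnj (\<i> + cis t) \<noteq> 0" by (simp only: complex_cnj_zero_iff not_False_eq_True)
    moreover have "cnj (1 + \<i> * cis t) * (\<i> + cis t) = (1 + \<i> * cis t) * cnj (\<i> + cis t)"
      using z by (simp add: algebra_simps)
    ultimately show ?thesis using False unfolding multiplier_def complex_cnj_divide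
      by (simp add: frac_eq_eq)
  qed (simp add: multiplier_def)
qed

text \<open>From \<open>|\<lambda>(t)|\<^sup>2 = (1 - sin t) / (1 + sin t)\<close>, which is decreasing in \<open>sin t\<close>, all comparisons of \<open>|\<lambda>|\<close>
with the growth rate become comparisons of \<open>sin t\<close> with \<open>\<plusminus> sin \<alpha>\<close>.\<close>
lemma growth_rate_sq:
  assumes "0 < \<alpha>" "\<alpha> < pi / 2"
  shows "0 < growth_rate \<alpha>" "(growth_rate \<alpha>)\<^sup>2 * (1 - sin \<alpha>) = 1 + sin \<alpha>" "sin \<alpha> < 1" "0 < sin \<alpha>"
proof -
  have "0 < cos \<alpha>" using assms by (intro cos_gt_zero_pi) auto
  then have "(sin \<alpha>)\<^sup>2 < 1"
    using sin_cos_squared_add[of \<alpha>] zero_less_power[of "cos \<alpha>" 2] by linarith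
  then show s1: "sin \<alpha> < 1" by (simp add: abs_square_less_1)
  show s0: "0 < sin \<alpha>" using assms by (intro sin_gt_zero) auto
  have r2: "(growth_rate \<alpha>)\<^sup>2 = (2 + 2 * sin \<alpha>) / (2 - 2 * sin \<alpha>)"
    using cmod_multiplier_parts[of "-\<alpha>"] unfolding growth_rate_def discrete_exp_eq multiplier_def
      by (simp add: norm_divide norm_mult power_divide)
  show "(growth_rate \<alpha>)\<^sup>2 * (1 - sin \<alpha>) = 1 + sin \<alpha>"
    unfolding r2 using s1 by (simp add: field_simps)
  have "growth_rate \<alpha> \<noteq> 0" using r2 s0 s1 by (auto simp: field_simps)
  then show "0 < growth_rate \<alpha>" unfolding growth_rate_def by simp
qed

text \<open>Stated for abstract \<open>x\<close> and \<open>y\<close> with the squares of \<open>|\<i> + e\<^sup>i\<^sup>t|\<close> and \<open>|1 + \<i> e\<^sup>i\<^sup>t|\<close> at \<open>s = sin t\<close>; exchanging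
the two moduli amounts to replacing \<open>s\<close> by \<open>-s\<close>.\<close>
lemma growth_rate_mult_less:
  assumes "0 < \<alpha>" "\<alpha> < pi / 2" "x\<^sup>2 = 2 + 2 * s" "y\<^sup>2 = 2 - 2 * s" "0 \<le> y" "s < - sin \<alpha>"
  shows "x * growth_rate \<alpha> < y"
proof -
  note r = growth_rate_sq[OF assms(1,2)]
  have "(x * growth_rate \<alpha>)\<^sup>2 * (1 - sin \<alpha>) = (2 + 2 * s) * (1 + sin \<alpha>)"
    using r(2) by (simp add: power_mult_distrib assms(3) mult.assoc)
  also have "\<dots> < (2 - 2 * s) * (1 - sin \<alpha>)" using assms(6) by (simp add: algebra_simps)
  finally have "(x * growth_rate \<alpha>)\<^sup>2 < y\<^sup>2" using r(3) by (simp add: assms(4))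
  then show ?thesis by (rule power2_less_imp_less[OF _ assms(5)])
qed

lemma growth_rate_mult_le:
  assumes "0 < \<alpha>" "\<alpha> < pi / 2" "x\<^sup>2 = 2 + 2 * s" "y\<^sup>2 = 2 - 2 * s" "0 \<le> x" "- sin \<alpha> \<le> s"
  shows "y \<le> x * growth_rate \<alpha>"
proof -
  note r = growth_rate_sq[OF assms(1,2)]
  have "y\<^sup>2 * (1 - sin \<alpha>) = (2 - 2 * s) * (1 - sin \<alpha>)" by (simp add: assms(4))
  also have "\<dots> \<le> (2 + 2 * s) * (1 + sin \<alpha>)" using assms(6) by (simp add: algebra_simps)
  also have "\<dots> = (x * growth_rate \<alpha>)\<^sup>2 * (1 - sin \<alpha>)"
    using r(2) by (simp add: power_mult_distrib assms(3) mult.assoc)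
  finally have "y\<^sup>2 \<le> (x * growth_rate \<alpha>)\<^sup>2" using r(3) by simp
  then show ?thesis by (rule power2_le_imp_le) (use assms r in simp)
qed

lemma sin_D_set:
  assumes a: "0 < \<alpha>" "\<alpha> < pi / 2" and t: "t \<in> D_set \<alpha>"
  shows "\<bar>sin t\<bar> \<le> sin \<alpha>"
proof -
  have *: "sin s \<le> sin \<alpha> \<and> 0 \<le> sin s" if "0 \<le> s" "s \<le> \<alpha>" for s
    using that a by (auto intro!: sin_monotone_2pi_le sin_ge_zero)
  have "sin \<bar>t\<bar> \<le> sin \<alpha> \<and> 0 \<le> sin \<bar>t\<bar>"
    using t *[of "\<bar>t\<bar>"] *[of "pi - \<bar>t\<bar>"] by (auto simp: D_set_def)
  then show ?thesis by (cases "t \<ge> 0") auto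
qed

lemma D_set_complement:
  assumes a: "0 < \<alpha>" "\<alpha> < pi / 2"
  shows "{-pi..<pi} = D_set \<alpha> \<union> {-pi + \<alpha><..<-\<alpha>} \<union> {\<alpha><..<pi - \<alpha>}"
    and "D_set \<alpha> \<inter> {-pi + \<alpha><..<-\<alpha>} = {}" "D_set \<alpha> \<inter> {\<alpha><..<pi - \<alpha>} = {}"
      "{-pi + \<alpha><..<-\<alpha>} \<inter> {\<alpha><..<pi - \<alpha>} = {}"
  using a unfolding D_set_def by auto

lemma sin_gt_on_gap:
  assumes a: "0 < \<alpha>" "\<alpha> < pi / 2" and t: "\<alpha> < t" "t < pi - \<alpha>"
  shows "sin \<alpha> < sin t"
proof (cases "t \<le> pi / 2")
  case True then show ?thesis using a t by (intro sin_monotone_2pi) auto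
next
  case False
  then have "sin \<alpha> < sin (pi - t)" using a t by (intro sin_monotone_2pi) auto
  then show ?thesis by simp
qed

lemma multiplier_powi_bound:
  assumes a: "0 < \<alpha>" "\<alpha> < pi / 2" and t: "t \<in> D_set \<alpha>"
  shows "cmod (multiplier t powi n) \<le> growth_rate \<alpha> ^ nat \<bar>n\<bar>"
proof -
  have s: "- sin \<alpha> \<le> sin t" "- sin \<alpha> \<le> - sin t" using sin_D_set[OF assms] by auto
  note r = growth_rate_sq[OF a]
  have pos: "0 < cmod (1 + \<i> * cis t)" "0 < cmod (\<i> + cis t)"
    using cmod_multiplier_parts[of t] s r by (auto simp del: norm_le_zero_iff intro: ccontr)
  have "cmod (1 + \<i> * cis t) \<le> cmod (\<i> + cis t) * growth_rate \<alpha>"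
    by (rule growth_rate_mult_le[OF a _ _ _ s(1)]) (simp_all add: cmod_multiplier_parts)
  moreover have "cmod (\<i> + cis t) \<le> cmod (1 + \<i> * cis t) * growth_rate \<alpha>"
    by (rule growth_rate_mult_le[OF a _ _ _ s(2)]) (simp_all add: cmod_multiplier_parts)
  ultimately have "cmod (multiplier t) \<le> growth_rate \<alpha>" "cmod (inverse (multiplier t)) \<le> growth_rate \<alpha>"
    using pos by (simp_all add: multiplier_def norm_divide field_simps)
  then show ?thesis
    unfolding power_int_def by (auto simp: norm_power intro!: power_mono)
qed

section \<open>Entire functions vanishing on the axis\<close>

lemma discrete_entire_iff:
  "discrete_entire F \<longleftrightarrow> (\<forall>m n. \<i> * F (m, n + 1) + F (m + 1, n + 1) = F (m, n) + \<i> * F (m + 1, n))"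
  unfolding discrete_entire_def by (intro all_cong1) (auto simp: algebra_simps)

text \<open>A linear recursion driven at its own frequency: \<open>b (m + k) = w\<^sup>k (b m + 2 k a m / w)\<close> grows linearly
in \<open>k\<close> unless the driving term is zero.\<close>
lemma resonance:
  fixes a b :: "int \<Rightarrow> complex"
  assumes w: "cmod w = 1" and a: "\<And>m. a (m + 1) = w * a m" and b: "\<And>m. b (m + 1) = w * b m + 2 * a m"
    and bd: "\<And>m. cmod (b m) \<le> B"
  shows "a m = 0"
proof -
  have an: "a (m + int k) = w ^ k * a m" for k
  proof (induction k)
    case (Suc k)
    have "a (m + int (Suc k)) = w * a (m + int k)" using a[of "m + int k"] by (simp add: add_ac)
    then show ?case by (simp add: Suc.IH)
  qed simp
  have bn: "w * b (m + int k) = w ^ k * (w * b m + 2 * of_nat k * a m)" for k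
  proof (induction k)
    case (Suc k)
    have "w * b (m + int (Suc k)) = w * (w * b (m + int k)) + 2 * w * a (m + int k)"
      using b[of "m + int k"] by (simp add: add_ac algebra_simps)
    then show ?case unfolding Suc.IH an by (simp add: algebra_simps)
  qed simp
  have "real k * (2 * cmod (a m)) \<le> 2 * B" for k
  proof -
    have "cmod (w * b m + 2 * of_nat k * a m) = cmod (b (m + int k))"
      using arg_cong[OF bn[of k], of cmod] w by (simp add: norm_mult norm_power)
    then have "cmod (w * b m + 2 * of_nat k * a m) \<le> B" using bd by simp
    moreover have "cmod (w * b m) \<le> B" using bd w by (simp add: norm_mult)
    ultimately have "cmod (2 * of_nat k * a m) \<le> B + B"
      using norm_triangle_ineq4[of "w * b m + 2 * of_nat k * a m" "w * b m"] by simp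
    then show ?thesis by (simp add: norm_mult)
  qed
  then have "2 * cmod (a m) \<le> 0"
    using reals_Archimedean3[of "2 * cmod (a m)"] by (meson not_less)
  then show ?thesis by simp
qed

text \<open>If row \<open>n\<close> vanishes, row \<open>n + 1\<close> is a multiple of \<open>(-\<i>)\<^sup>m\<close>, and it drives row \<open>n + 2\<close> at resonance. So
boundedness of each single row suffices. Downwards the same happens with \<open>\<i>\<close> in place of \<open>-\<i>\<close>.\<close>
lemma entire_vanishing_axis:
  assumes F: "discrete_entire F" and bd: "\<And>n. \<exists>B. \<forall>m. cmod (F (m, n)) \<le> B" and z: "\<And>m. F (m, 0) = 0"
  shows "F = 0"
proof -
  have eq: "\<i> * F (m, n + 1) + F (m + 1, n + 1) = F (m, n) + \<i> * F (m + 1, n)" for m n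
    using F by (simp add: discrete_entire_iff)
  have up: "F (m, n + 1) = 0" if 0: "\<forall>m. F (m, n) = 0" for n m
  proof -
    obtain B where B: "\<And>m. cmod (F (m, n + 2)) \<le> B" using bd by blast
    have a: "F (m + 1, n + 1) = - \<i> * F (m, n + 1)" for m
      using eq[of m n] 0 by (simp add: add_eq_0_iff)
    have "F (m + 1, n + 2) = F (m, n + 1) + \<i> * F (m + 1, n + 1) - \<i> * F (m, n + 2)" for m
      using eq[of m "n + 1"] by (simp add: algebra_simps)
    then have "F (m + 1, n + 2) = - \<i> * F (m, n + 2) + 2 * F (m, n + 1)" for m
      by (simp add: a)
    from resonance[of "- \<i>" "\<lambda>m. F (m, n + 1)", OF _ a this B] show ?thesis by simp
  qed
  have down: "F (m, n - 1) = 0" if 0: "\<forall>m. F (m, n) = 0" for n m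
  proof -
    obtain B where B: "\<And>m. cmod (F (m, n - 2)) \<le> B" using bd by blast
    have a: "F (m + 1, n - 1) = \<i> * F (m, n - 1)" for m
    proof -
      have "\<i> * (F (m, n - 1) + \<i> * F (m + 1, n - 1)) = 0" using eq[of m "n - 1"] 0 by simp
      then show ?thesis by (simp add: distrib_left flip: mult.assoc)
    qed
    have "F (m + 1, n - 2) = \<i> * F (m, n - 2) + 2 * F (m, n - 1)" for m
    proof -
      have "\<i> * F (m, n - 1) + \<i> * F (m, n - 1) = F (m, n - 2) + \<i> * F (m + 1, n - 2)"
        using eq[of m "n - 2"] by (simp add: a)
      then have "- \<i> * (\<i> * F (m, n - 1) + \<i> * F (m, n - 1)) = - \<i> * (F (m, n - 2) + \<i> * F (m + 1, n - 2))"
        by simp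
      then show ?thesis by (simp add: algebra_simps)
    qed
    from resonance[of "\<i>" "\<lambda>m. F (m, n - 1)", OF _ a this B] show ?thesis by simp
  qed
  have "\<forall>m. F (m, n) = 0" for n
    by (induction n rule: int_induct[where k = 0]) (use z up down in auto)
  then show ?thesis by (auto simp: fun_eq_iff)
qed

text \<open>On \<open>[a,b]\<close> the functions \<open>1 - exp(-k (t-a)(b-t))\<close> vanish at the ends and increase to the indicator of
\<open>(a,b)\<close>; then \<open>(a,b)\<close> increases to \<open>(x,y)\<close>.\<close>
lemma pairing_open_interval_eq_0:
  assumes f: "l2 f" and xy: "x < y"
    and van: "\<And>a b g g'. x < a \<Longrightarrow> a < b \<Longrightarrow> b < y \<Longrightarrow> C1_vanishing a b g g' \<Longrightarrow> pairing f (cut_to a b g) = 0"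
  shows "pairing f (\<lambda>t. indicator {x<..<y} t *\<^sub>R cis (of_int m * t)) = 0"
proof -
  let ?e = "\<lambda>t. cis (of_int m * t)"
  have closed: "pairing f (\<lambda>t. indicator {a<..<b} t *\<^sub>R ?e t) = 0"
    if ab: "x < a" "a < b" "b < y" for a b
  proof -
    define r where "r k t = 1 - exp (- (real k * ((t - a) * (b - t))))" for k t
    have r01: "0 \<le> r k t" "r k t \<le> 1" if "a \<le> t" "t \<le> b" for k t
      using that by (simp_all add: r_def)
    define r' where "r' k t = - (exp (- (real k * ((t - a) * (b - t)))) * (- (real k * ((b - t) - (t - a)))))" for k t
    have "((\<lambda>t. complex_of_real (r k t)) has_vector_derivative complex_of_real (r' k t)) (at t within {a..b})" for k t
      unfolding r_def r'_def
        by (intro has_vector_derivative_of_real) (auto intro!: derivative_eq_intros)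
    then have "C1_vanishing a b (\<lambda>t. complex_of_real (r k t)) (\<lambda>t. complex_of_real (r' k t))" for k
      unfolding C1_vanishing_def by (auto simp: r_def r'_def intro!: continuous_intros)
    then have b: "C1_vanishing a b (\<lambda>t. ?e t * r k t) (\<lambda>t. ?e t * r' k t + \<i> * of_real (of_int m) * ?e t * r k t)" for k
      by (intro C1_vanishing_mult has_vector_derivative_cis_mult continuous_intros)
    have 0: "pairing f (cut_to a b (\<lambda>t. ?e t * r k t)) = 0" for k
      by (rule van[OF ab b])
    have "(\<lambda>k. pairing f (cut_to a b (\<lambda>t. ?e t * r k t))) \<longlonglongrightarrow> pairing f (\<lambda>t. indicator {a<..<b} t *\<^sub>R ?e t)"
    proof (rule pairing_tendsto[OF f, of _ _ 1])
      show "cut_to a b (\<lambda>t. ?e t * r k t) \<in> borel_measurable borel" for k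
        by (intro bdd_borel_measurable bdd_borel_cut_to C1_vanishing_continuous[OF b])
      show "cmod (cut_to a b (\<lambda>t. ?e t * r k t) t) \<le> 1" for k t
        using r01 by (auto simp: indicator_def norm_mult)
      show "(\<lambda>k. cut_to a b (\<lambda>t. ?e t * r k t) t) \<longlonglongrightarrow> indicator {a<..<b} t *\<^sub>R ?e t" for t
      proof (cases "t \<in> {a<..<b}")
        case True
        then have p: "0 < (t - a) * (b - t)" by simp
        have "(\<lambda>k. r k t) \<longlonglongrightarrow> 1"
        proof -
          have "(\<lambda>k. 1 - exp (- ((t - a) * (b - t))) ^ k) \<longlonglongrightarrow> 1 - 0"
            using p by (intro tendsto_diff tendsto_const LIMSEQ_power_zero) simp
          then show ?thesis by (simp add: r_def flip: exp_of_nat_mult)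
        qed
        then have "(\<lambda>k. ?e t * of_real (r k t)) \<longlonglongrightarrow> ?e t * of_real 1"
          by (intro tendsto_intros)
        then show ?thesis using True by simp
      next
        case False
        then have *: "cut_to a b (\<lambda>t. ?e t * r k t) t = indicator {a<..<b} t *\<^sub>R ?e t" for k
          by (auto simp: r_def indicator_def)
        show ?thesis unfolding * by (rule tendsto_const)
      qed
    qed
    then show ?thesis unfolding 0 by (simp add: LIMSEQ_const_iff)
  qed
  \<comment> \<open>The denominator \<open>k + 3\<close> keeps the shrunken interval nonempty from the start.\<close>
  define d where "d k = (y - x) / real (k + 3)" for k :: nat
  have d0: "0 < d k" for k using xy by (simp add: d_def)
  have d1: "x + d k < y - d k" for k
  proof -
    have "d k * 3 \<le> d k * real (k + 3)" using d0[of k] by (intro mult_left_mono) auto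
    also have "\<dots> = y - x" by (simp add: d_def)
    finally show ?thesis using d0[of k] by linarith
  qed
  have dlim: "d \<longlonglongrightarrow> 0" unfolding d_def by (rule LIMSEQ_ignore_initial_segment[OF lim_const_over_n])
  have 0: "pairing f (\<lambda>t. indicator {x + d k<..<y - d k} t *\<^sub>R ?e t) = 0" for k
    using closed[of "x + d k" "y - d k"] d0[of k] d1[of k] by simp
  have "(\<lambda>k. pairing f (\<lambda>t. indicator {x + d k<..<y - d k} t *\<^sub>R ?e t)) \<longlonglongrightarrow> pairing f (\<lambda>t. indicator {x<..<y} t *\<^sub>R ?e t)"
  proof (rule pairing_tendsto[OF f, of _ _ 1])
    show "(\<lambda>k. indicator {x + d k<..<y - d k} t *\<^sub>R ?e t) \<longlonglongrightarrow> indicator {x<..<y} t *\<^sub>R ?e t" for t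
    proof (cases "t \<in> {x<..<y}")
      case True
      then have "0 < min (t - x) (y - t)" by simp
      from order_tendstoD(2)[OF dlim this] have "\<forall>\<^sub>F k in sequentially. indicator {x + d k<..<y - d k} t *\<^sub>R ?e t = indicator {x<..<y} t *\<^sub>R ?e t"
        by eventually_elim (use True in auto)
      then show ?thesis by (rule tendsto_eventually)
    next
      case False
      then have "indicator {x + d k<..<y - d k} t *\<^sub>R ?e t = indicator {x<..<y} t *\<^sub>R ?e t" for k
        using d0[of k] by (auto simp: indicator_def)
      then show ?thesis by simp
    qed
  qed (auto simp: indicator_def)
  then show ?thesis unfolding 0 by (simp add: LIMSEQ_const_iff)
qed

section \<open>The representation of functions in \<open>PW\<^sub>\<alpha>\<close>\<close>

text \<open>The discrete exponential cut down to \<open>D\<^sub>\<alpha>\<close>, as a function of \<open>t\<close>; there the poles and zeros of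
\<open>\<lambda>\<close> are avoided, and the powers of \<open>\<lambda>\<close> are bounded.\<close>
definition band_exp :: "real \<Rightarrow> int \<Rightarrow> int \<Rightarrow> real \<Rightarrow> complex" where
  "band_exp \<alpha> m n t = indicator (D_set \<alpha>) t *\<^sub>R discrete_exp t (m, n)"

lemma D_set_borel [measurable]: "D_set \<alpha> \<in> sets borel"
proof -
  have "D_set \<alpha> = {-pi..<pi} \<inter> ({-\<alpha>..\<alpha>} \<union> ({-pi..\<alpha>-pi} \<union> {pi-\<alpha>..pi}))"
    unfolding D_set_def by auto
  then show ?thesis by simp
qed

lemma fourier_coeff_cong:
  assumes "h \<in> borel_measurable borel" "k \<in> borel_measurable borel" "\<And>t. t \<in> {-pi..<pi} \<Longrightarrow> h t = k t"
  shows "fourier_coeff h = fourier_coeff k"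
proof
  fix u
  have "(LINT t:{-pi..<pi}|lborel. h t * cis (- of_int u * t)) = (LINT t:{-pi..<pi}|lborel. k t * cis (- of_int u * t))"
    by (rule set_lebesgue_integral_cong) (use assms(3) in auto)
  then show "fourier_coeff h u = fourier_coeff k u"
    unfolding fourier_coeff_def using assms(1,2) by (simp add: integral_torus)
qed

context
  fixes \<alpha> :: real
  assumes \<alpha>: "0 < \<alpha>" "\<alpha> < pi / 2"
begin

abbreviation R where "R \<equiv> growth_rate \<alpha>"

lemma growth_rate_pos: "0 < R" by (rule growth_rate_sq[OF \<alpha>])

lemma band_exp_bound: "cmod (band_exp \<alpha> m n t) \<le> R ^ nat \<bar>n\<bar>"
  using multiplier_powi_bound[OF \<alpha>, of t n] growth_rate_pos
  by (auto simp: band_exp_def discrete_exp_eq norm_mult indicator_def)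

lemma band_exp_measurable [measurable]: "band_exp \<alpha> m n \<in> borel_measurable borel"
proof -
  have [measurable]: "multiplier \<in> borel_measurable borel"
    unfolding multiplier_def[abs_def] by measurable
  have "(\<lambda>t. multiplier t powi n) \<in> borel_measurable borel"
    unfolding power_int_def by (cases "n \<ge> 0") simp_all
  then show ?thesis unfolding band_exp_def[abs_def] discrete_exp_eq by measurable
qed

lemma bdd_borel_band_exp: "bdd_borel (band_exp \<alpha> m n)"
  using band_exp_bound unfolding bdd_borel_def by auto

lemma D_set_nonpole:
  assumes "t \<in> D_set \<alpha>" shows "\<i> + cis t \<noteq> 0" "multiplier t \<noteq> 0"
proof -
  have s: "\<bar>sin t\<bar> < 1" using sin_D_set[OF \<alpha> assms] growth_rate_sq(3)[OF \<alpha>] by simp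
  then have "cmod (\<i> + cis t) \<noteq> 0" "cmod (1 + \<i> * cis t) \<noteq> 0"
    using cmod_multiplier_parts[of t] by (auto simp del: norm_eq_zero)
  then show "\<i> + cis t \<noteq> 0" "multiplier t \<noteq> 0" by (auto simp: multiplier_def)
qed

lemma band_exp_entire:
  "\<i> * band_exp \<alpha> m (n + 1) t + band_exp \<alpha> (m + 1) (n + 1) t = band_exp \<alpha> m n t + \<i> * band_exp \<alpha> (m + 1) n t"
proof (cases "t \<in> D_set \<alpha>")
  case True
  have l: "(\<i> + cis t) * multiplier t = 1 + \<i> * cis t"
    using D_set_nonpole[OF True] by (simp add: multiplier_def)
  have c: "cis (of_int (m + 1) * t) = cis (of_int m * t) * cis t"
    by (subst cis_mult) (simp add: algebra_simps)
  have p: "multiplier t powi (n + 1) = multiplier t * multiplier t powi n"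
    using D_set_nonpole(2)[OF True] by (simp add: power_int_add)
  have "\<i> * band_exp \<alpha> m (n + 1) t + band_exp \<alpha> (m + 1) (n + 1) t =
      cis (of_int m * t) * multiplier t powi n * ((\<i> + cis t) * multiplier t)"
    using True unfolding band_exp_def discrete_exp_eq c p by (simp add: algebra_simps)
  also have "\<dots> = band_exp \<alpha> m n t + \<i> * band_exp \<alpha> (m + 1) n t"
    using True unfolding band_exp_def discrete_exp_eq c l by (simp add: algebra_simps)
  finally show ?thesis .
qed (simp add: band_exp_def)

text \<open>The entire function whose axis sequence is the projection of \<open>f\<close> to spectrum in \<open>D\<^sub>\<alpha>\<close>.\<close>
definition extension :: "(int \<Rightarrow> complex) \<Rightarrow> int \<times> int \<Rightarrow> complex" where
  "extension f = (\<lambda>(m, n). pairing f (band_exp \<alpha> m n))"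

lemma extension_entire: "l2 f \<Longrightarrow> discrete_entire (extension f)"
  unfolding discrete_entire_iff extension_def
  by (simp add: bdd_borel_intros bdd_borel_band_exp band_exp_entire flip: pairing_scale pairing_add)

lemma torus_norm_band_exp: "torus_norm (band_exp \<alpha> m n) \<le> R ^ nat \<bar>n\<bar>"
  by (rule torus_norm_bound[OF band_exp_measurable band_exp_bound])

lemma extension_bound:
  assumes "l2 f" shows "cmod (extension f (m, n)) \<le> l2norm f * R ^ nat \<bar>n\<bar>"
  using pairing_bound[OF assms bdd_borel_band_exp, of m n] mult_left_mono[OF torus_norm_band_exp[of m n], of "l2norm f"]
  by (simp add: extension_def)

lemma PW_iff:
  "F \<in> PW \<alpha> \<longleftrightarrow> discrete_entire F \<and> (\<exists>c>0. \<forall>m n. cmod (F (m, n)) \<le> c * R ^ nat \<bar>n\<bar>) \<and> l2 (\<lambda>m. F (m, 0))"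
  unfolding PW_def l2_def growth_rate_def by simp

text \<open>The torus splits into \<open>D\<^sub>\<alpha>\<close> and two gaps. On the gap around \<open>-\<pi>/2\<close>, \<open>|\<lambda>|\<close> exceeds the growth rate and
the rows \<open>n \<ge> 0\<close> rule out spectrum; on the gap around \<open>\<pi>/2\<close>, \<open>1/|\<lambda>|\<close> exceeds it and the rows \<open>n \<le> 0\<close> do.\<close>
lemma extension_axis:
  assumes F: "F \<in> PW \<alpha>"
  shows "extension (\<lambda>m. F (m, 0)) (m, 0) = F (m, 0)"
proof -
  let ?f = "\<lambda>m. F (m, 0)" and ?e = "\<lambda>t. cis (of_int m * t)"
  let ?J = "{-pi + \<alpha><..<-\<alpha>}" and ?J' = "{\<alpha><..<pi - \<alpha>}"
  obtain c where F': "discrete_entire F" "\<And>m n. cmod (F (m, n)) \<le> c * R ^ nat \<bar>n\<bar>" "l2 ?f"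
    using F unfolding PW_iff by blast
  have eq: "\<i> * F (m, n + 1) + F (m + 1, n + 1) = F (m, n) + \<i> * F (m + 1, n)" for m n
    using F'(1) by (simp add: discrete_entire_iff)
  have 1: "pairing ?f (\<lambda>t. indicator ?J t *\<^sub>R ?e t) = 0"
  proof (rule pairing_open_interval_eq_0[OF F'(3)])
    fix a b g g' assume ab: "-pi + \<alpha> < a" "a < b" "b < -\<alpha>" and g: "C1_vanishing a b g g'"
    have "(\<Sum>\<^sub>\<infinity>u. F (u, int 0) * fourier_coeff (cut_to a b g) u) = 0"
    proof (rule growth_annihilates[where f = "\<lambda>n u. F (u, int n)" and c = c and R = R])
      show "\<i> * F (u, int (Suc n)) + 1 * F (u + 1, int (Suc n)) = 1 * F (u, int n) + \<i> * F (u + 1, int n)" for n u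
        using eq[of u "int n"] by (simp add: add_ac)
      show "cmod (F (u, int n)) \<le> c * R ^ n" for n u using F'(2)[of u "int n"] by simp
      show "cmod (\<i> + 1 * cis t) * R < cmod (1 + \<i> * cis t)" if "t \<in> {a..b}" for t
        using sin_gt_on_gap[OF \<alpha>, of "-t"] that ab
        by (intro growth_rate_mult_less[OF \<alpha>, of _ "sin t"]) (simp_all add: cmod_multiplier_parts)
    qed (use growth_rate_pos ab \<alpha> g in auto)
    then show "pairing ?f (cut_to a b g) = 0" by (simp add: pairing_def)
  qed (use \<alpha> in simp)
  have 2: "pairing ?f (\<lambda>t. indicator ?J' t *\<^sub>R ?e t) = 0"
  proof (rule pairing_open_interval_eq_0[OF F'(3)])
    fix a b g g' assume ab: "\<alpha> < a" "a < b" "b < pi - \<alpha>" and g: "C1_vanishing a b g g'"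
    have "(\<Sum>\<^sub>\<infinity>u. F (u, - int 0) * fourier_coeff (cut_to a b g) u) = 0"
    proof (rule growth_annihilates[where f = "\<lambda>n u. F (u, - int n)" and c = c and R = R])
      show "1 * F (u, - int (Suc n)) + \<i> * F (u + 1, - int (Suc n)) = \<i> * F (u, - int n) + 1 * F (u + 1, - int n)" for n u
        using eq[of u "- int (Suc n)"] by simp
      show "cmod (F (u, - int n)) \<le> c * R ^ n" for n u using F'(2)[of u "- int n"] by simp
      show "cmod (1 + \<i> * cis t) * R < cmod (\<i> + 1 * cis t)" if "t \<in> {a..b}" for t
        using sin_gt_on_gap[OF \<alpha>, of t] that ab
        by (intro growth_rate_mult_less[OF \<alpha>, of _ "- sin t"]) (simp_all add: cmod_multiplier_parts)
    qed (use growth_rate_pos ab \<alpha> g in auto)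
    then show "pairing ?f (cut_to a b g) = 0" by (simp add: pairing_def)
  qed (use \<alpha> in simp)
  have ind: "bdd_borel (\<lambda>t. indicator ?J t *\<^sub>R ?e t)" "bdd_borel (\<lambda>t. indicator ?J' t *\<^sub>R ?e t)"
    unfolding bdd_borel_def by (auto intro!: exI[of _ 1] simp: indicator_def)
  have "fourier_coeff ?e = fourier_coeff (\<lambda>t. band_exp \<alpha> m 0 t + (indicator ?J t *\<^sub>R ?e t + indicator ?J' t *\<^sub>R ?e t))"
  proof (rule fourier_coeff_cong)
    fix t assume "t \<in> {-pi..<pi}"
    then show "?e t = band_exp \<alpha> m 0 t + (indicator ?J t *\<^sub>R ?e t + indicator ?J' t *\<^sub>R ?e t)"
      using D_set_complement[OF \<alpha>] by (auto simp: band_exp_def discrete_exp_eq indicator_def)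
  qed (intro bdd_borel_measurable bdd_borel_intros bdd_borel_band_exp ind)+
  then have "F (m, 0) = pairing ?f (\<lambda>t. band_exp \<alpha> m 0 t + (indicator ?J t *\<^sub>R ?e t + indicator ?J' t *\<^sub>R ?e t))"
    using pairing_cis[of ?f m] by (simp add: pairing_def)
  also have "\<dots> = pairing ?f (band_exp \<alpha> m 0) + (0 + 0)"
    unfolding pairing_add[OF F'(3) bdd_borel_band_exp bdd_borel_add[OF ind]] pairing_add[OF F'(3) ind] 1 2 ..
  finally show ?thesis
    by (simp add: extension_def)
qed

lemma PW_representation:
  assumes F: "F \<in> PW \<alpha>"
  shows "F (m, n) = pairing (\<lambda>m. F (m, 0)) (band_exp \<alpha> m n)"
proof -
  let ?f = "\<lambda>m. F (m, 0)"
  obtain c where F': "discrete_entire F" "\<And>m n. cmod (F (m, n)) \<le> c * R ^ nat \<bar>n\<bar>" "l2 ?f"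
    using F unfolding PW_iff by blast
  define E where "E = (\<lambda>x. F x - extension ?f x)"
  have "E = 0"
  proof (rule entire_vanishing_axis)
    show "discrete_entire E"
      using F'(1) extension_entire[OF F'(3)] unfolding E_def discrete_entire_def
      by (simp add: right_diff_distrib diff_diff_eq2 diff_diff_eq add_ac) (simp add: algebra_simps)
    show "\<exists>B. \<forall>m. cmod (E (m, n)) \<le> B" for n
    proof (intro exI allI)
      fix m
      show "cmod (E (m, n)) \<le> c * R ^ nat \<bar>n\<bar> + l2norm ?f * R ^ nat \<bar>n\<bar>"
        unfolding E_def by (intro order_trans[OF norm_triangle_ineq4] add_mono F' extension_bound)
    qed
    show "E (m, 0) = 0" for m by (simp add: E_def extension_axis[OF F])
  qed
  then have "E (m, n) = 0" by simp
  then show ?thesis by (simp add: E_def extension_def)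
qed

lemma PW_l2: "F \<in> PW \<alpha> \<Longrightarrow> l2 (\<lambda>m. F (m, 0))" by (simp add: PW_iff)

lemma PW_norm_eq: "PW_norm F = l2norm (\<lambda>m. F (m, 0))"
  by (simp add: PW_norm_def l2norm_def)

lemma PW_pointwise_bound:
  assumes F: "F \<in> PW \<alpha>"
  shows "cmod (F (m, n)) \<le> PW_norm F * R ^ nat \<bar>n\<bar>"
  using extension_bound[OF PW_l2[OF F], of m n] PW_representation[OF F, of m n]
  by (simp add: extension_def PW_norm_eq)

section \<open>The reproducing kernel\<close>

definition PW_kernel :: "int \<times> int \<Rightarrow> int \<times> int \<Rightarrow> complex" where
  "PW_kernel = (\<lambda>(m, n) (u, v). fourier_coeff (band_exp \<alpha> u (v + n)) m)"

text \<open>Because \<open>\<lambda>\<close> is real, conjugation only changes the sign of the frequency \<open>m - u\<close>. This makes the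
kernel Hermitian and turns the pairing into an inner product.\<close>
lemma cnj_fourier_coeff_band_exp: "cnj (fourier_coeff (band_exp \<alpha> m n) u) = fourier_coeff (band_exp \<alpha> u n) m"
proof -
  have "cnj (fourier_coeff (band_exp \<alpha> m n) u) = (LINT t|torus. cnj (band_exp \<alpha> m n t * cis (- of_int u * t)))"
    unfolding fourier_coeff_def by (rule Bochner_Integration.integral_cnj[symmetric])
  also have "\<dots> = fourier_coeff (band_exp \<alpha> u n) m"
    unfolding fourier_coeff_def
  proof (intro Bochner_Integration.integral_cong refl)
    fix t
    have "cnj (multiplier t powi n) = multiplier t powi n"
      by (simp add: power_int_def multiplier_real)
    then show "cnj (band_exp \<alpha> m n t * cis (- of_int u * t)) = band_exp \<alpha> u n t * cis (- of_int m * t)"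
      by (simp add: band_exp_def discrete_exp_eq cis_cnj)
  qed
  finally show ?thesis .
qed

lemma PW_kernel_in_PW: "PW_kernel x \<in> PW \<alpha>"
proof (cases x)
  case (Pair m n)
  have R1: "R \<ge> 1"
  proof -
    have "0 \<in> D_set \<alpha>" using \<alpha> by (auto simp: D_set_def)
    then have "cmod (multiplier 0 powi 1) \<le> R" using multiplier_powi_bound[OF \<alpha>, of 0 1] by simp
    moreover have "multiplier 0 = 1"
    proof -
      have "\<i> + 1 \<noteq> 0" by (simp add: complex_eq_iff)
      then show ?thesis by (simp add: multiplier_def add.commute)
    qed
    ultimately show ?thesis by simp
  qed
  have "\<i> * fourier_coeff (band_exp \<alpha> u (v + 1 + n)) m + fourier_coeff (band_exp \<alpha> (u + 1) (v + 1 + n)) m =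
      fourier_coeff (band_exp \<alpha> u (v + n)) m + \<i> * fourier_coeff (band_exp \<alpha> (u + 1) (v + n)) m" for u v
  proof -
    have v: "v + 1 + n = (v + n) + 1" by simp
    show ?thesis
      unfolding v by (simp add: bdd_borel_intros bdd_borel_band_exp band_exp_entire flip: fourier_coeff_scale fourier_coeff_add)
  qed
  then have "discrete_entire (PW_kernel (m, n))"
    unfolding discrete_entire_iff PW_kernel_def by simp
  moreover have "cmod (PW_kernel (m, n) (u, v)) \<le> R ^ nat \<bar>n\<bar> * R ^ nat \<bar>v\<bar>" for u v
  proof -
    have "cmod (PW_kernel (m, n) (u, v)) \<le> R ^ nat \<bar>v + n\<bar>"
      unfolding PW_kernel_def
        by (simp add: fourier_coeff_bound[OF band_exp_measurable band_exp_bound])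
    also have "\<dots> \<le> R ^ (nat \<bar>n\<bar> + nat \<bar>v\<bar>)"
      by (intro power_increasing R1) auto
    finally show ?thesis by (simp add: power_add)
  qed
  moreover have "l2 (\<lambda>u. PW_kernel (m, n) (u, 0))"
    using fourier_coeff_Bessel(1)[OF bdd_borel_band_exp, of m n] l2_cnj(1)[of "fourier_coeff (band_exp \<alpha> m n)"]
    by (simp add: PW_kernel_def cnj_fourier_coeff_band_exp)
  ultimately show ?thesis unfolding PW_iff Pair using growth_rate_pos
    by (intro conjI exI[of _ "R ^ nat \<bar>n\<bar>"]) auto
qed

lemma PW_kernel_reproduces:
  assumes "F \<in> PW \<alpha>" shows "F x = PW_inner F (PW_kernel x)"
  using PW_representation[OF assms, of "fst x" "snd x"]
  by (cases x) (simp add: PW_inner_def pairing_def PW_kernel_def cnj_fourier_coeff_band_exp)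

lemma PW_kernel_integral:
  "PW_kernel (m, n) (u, v) = 1 / (2 * pi) * (LINT t:D_set \<alpha>|lborel. discrete_exp t (u - m, v + n))"
proof -
  have "band_exp \<alpha> u (v + n) t * cis (- of_int m * t) = band_exp \<alpha> (u - m) (v + n) t" for t
  proof -
    have "cis (of_int (u - m) * t) = cis (of_int u * t) * cis (- of_int m * t)"
      by (subst cis_mult) (simp add: algebra_simps)
    then show ?thesis by (simp add: band_exp_def discrete_exp_eq mult_ac)
  qed
  then have "PW_kernel (m, n) (u, v) = (LINT t|torus. band_exp \<alpha> (u - m) (v + n) t)"
    by (simp add: PW_kernel_def fourier_coeff_def)
  also have "\<dots> = (1 / (2 * pi)) *\<^sub>R (LINT t:{-pi..<pi}|lborel. band_exp \<alpha> (u - m) (v + n) t)"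
    by (rule integral_torus[OF band_exp_measurable])
  also have "(LINT t:{-pi..<pi}|lborel. band_exp \<alpha> (u - m) (v + n) t) = (LINT t:D_set \<alpha>|lborel. discrete_exp t (u - m, v + n))"
    unfolding set_lebesgue_integral_def band_exp_def
    by (intro Bochner_Integration.integral_cong refl) (auto simp: indicator_def D_set_def)
  finally show ?thesis by (simp add: scaleR_conv_of_real)
qed

section \<open>The Hilbert space\<close>

lemma PW_add:
  assumes F: "F \<in> PW \<alpha>" and G: "G \<in> PW \<alpha>" shows "F + G \<in> PW \<alpha>"
proof -
  obtain c where c: "c > 0" "\<And>m n. cmod (F (m, n)) \<le> c * growth_rate \<alpha> ^ nat \<bar>n\<bar>"
    using F unfolding PW_iff by blast
  obtain d where d: "d > 0" "\<And>m n. cmod (G (m, n)) \<le> d * growth_rate \<alpha> ^ nat \<bar>n\<bar>"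
    using G unfolding PW_iff by blast
  have "discrete_entire (F + G)"
    using F G unfolding PW_iff discrete_entire_iff by (auto simp: algebra_simps)
  moreover have "cmod ((F + G) (m, n)) \<le> (c + d) * growth_rate \<alpha> ^ nat \<bar>n\<bar>" for m n
    using norm_triangle_mono[OF c(2) d(2)] by (simp add: distrib_right)
  moreover have "l2 (\<lambda>m. (F + G) (m, 0))"
    using l2_add(1)[OF PW_l2[OF F] PW_l2[OF G]] by simp
  ultimately show ?thesis unfolding PW_iff using c(1) d(1)
    by (intro conjI exI[of _ "c + d"]) auto
qed

lemma PW_scale:
  assumes F: "F \<in> PW \<alpha>" shows "(\<lambda>x. k * F x) \<in> PW \<alpha>"
proof -
  obtain c where c: "c > 0" "\<And>m n. cmod (F (m, n)) \<le> c * growth_rate \<alpha> ^ nat \<bar>n\<bar>"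
    using F unfolding PW_iff by blast
  have "discrete_entire (\<lambda>x. k * F x)"
  proof -
    have "\<i> * F (m, n + 1) + F (m + 1, n + 1) = F (m, n) + \<i> * F (m + 1, n)" for m n
      using F unfolding PW_iff discrete_entire_iff by blast
    from arg_cong[OF this, of "\<lambda>z. k * z"] show ?thesis
      unfolding discrete_entire_iff by (simp add: algebra_simps)
  qed
  moreover have "cmod (k * F (m, n)) \<le> ((cmod k + 1) * c) * growth_rate \<alpha> ^ nat \<bar>n\<bar>" for m n
    unfolding norm_mult mult.assoc by (intro mult_mono c(2)) auto
  moreover have "l2 (\<lambda>m. k * F (m, 0))" by (rule l2_scale[OF PW_l2[OF F]])
  ultimately show ?thesis unfolding PW_iff using c(1)
    by (intro conjI exI[of _ "(cmod k + 1) * c"]) (auto intro!: mult_pos_pos add_nonneg_pos)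
qed

lemma PW_diff:
  assumes F: "F \<in> PW \<alpha>" and G: "G \<in> PW \<alpha>" shows "F - G \<in> PW \<alpha>"
  using PW_add[OF F PW_scale[OF G, of "-1"]] by (simp add: fun_eq_iff fun_diff_def plus_fun_def)

lemma PW_subspace: "csubspace (PW \<alpha>)"
proof -
  have "0 \<in> PW \<alpha>"
    unfolding PW_iff using growth_rate_sq(1)[OF \<alpha>]
    by (auto simp: discrete_entire_iff l2_def intro!: exI[of _ 1])
  then show ?thesis unfolding fun_cvs.subspace_def by (auto intro: PW_add PW_scale)
qed

lemma PW_inner_summable:
  "F \<in> PW \<alpha> \<Longrightarrow> G \<in> PW \<alpha> \<Longrightarrow> (\<lambda>u. F (u, 0) * cnj (G (u, 0))) summable_on UNIV"
  by (rule l2_Cauchy_Schwarz(3)) (simp_all add: PW_l2)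

lemma PW_inner_product: "complex_inner_product_on (PW \<alpha>) PW_inner PW_norm"
proof
  show "csubspace (PW \<alpha>)" by (rule PW_subspace)
  show "PW_inner (F + G) H = PW_inner F H + PW_inner G H"
    if "F \<in> PW \<alpha>" "G \<in> PW \<alpha>" "H \<in> PW \<alpha>" for F G H
    unfolding PW_inner_def using that by (simp add: distrib_right infsum_add PW_inner_summable)
  show "PW_inner (\<lambda>x. c * F x) G = c * PW_inner F G" if "F \<in> PW \<alpha>" "G \<in> PW \<alpha>" for F G c
    unfolding PW_inner_def mult.assoc by (intro infsum_cmult_right PW_inner_summable that)
  show "PW_inner G F = cnj (PW_inner F G)" for F G
    unfolding PW_inner_def by (simp add: mult.commute flip: infsum_cnj)
  show "0 \<le> PW_norm F" for F by (simp add: PW_norm_eq)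
  show "PW_inner F F = complex_of_real ((PW_norm F)\<^sup>2)" if "F \<in> PW \<alpha>" for F
  proof -
    have "PW_inner F F = (\<Sum>\<^sub>\<infinity>u. complex_of_real ((cmod (F (u, 0)))\<^sup>2))"
      unfolding PW_inner_def by (intro infsum_cong) (simp only: complex_norm_square)
    also have "\<dots> = complex_of_real (\<Sum>\<^sub>\<infinity>u. (cmod (F (u, 0)))\<^sup>2)"
      using PW_l2[OF that] unfolding l2_def
      by (intro infsumI has_sum_of_real has_sum_infsum)
    finally show ?thesis by (simp add: PW_norm_eq l2norm_power2)
  qed
  show "F = 0" if F: "F \<in> PW \<alpha>" "PW_norm F = 0" for F
    using PW_pointwise_bound[OF F(1)] F(2) by (auto simp: fun_eq_iff)
qed

interpretation PW: complex_inner_product_on "PW \<alpha>" PW_inner PW_norm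
  by (rule PW_inner_product)

lemma PW_norm_diff: "PW_norm (F - G) = l2norm (\<lambda>m. F (m, 0) - G (m, 0))"
  by (simp add: PW_norm_eq)

lemma PW_metric: "Metric_space (PW \<alpha>) (\<lambda>F G. PW_norm (F - G))"
proof
  show "0 \<le> PW_norm (F - G)" for F G by (simp add: PW_norm_diff)
  show "PW_norm (F - G) = PW_norm (G - F)" for F G
    unfolding PW_norm_diff by (rule l2norm_minus_commute)
  show "PW_norm (F - G) = 0 \<longleftrightarrow> F = G" if "F \<in> PW \<alpha>" "G \<in> PW \<alpha>" for F G
  proof
    assume "PW_norm (F - G) = 0"
    with PW.nrm_zero[OF PW_diff[OF that]] show "F = G" by (simp add: fun_eq_iff)
  qed (simp add: PW_norm_eq l2norm_def)
  show "PW_norm (F - H) \<le> PW_norm (F - G) + PW_norm (G - H)"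
    if "F \<in> PW \<alpha>" "G \<in> PW \<alpha>" "H \<in> PW \<alpha>" for F G H
    using l2_add(2)[OF PW_l2[OF PW_diff[OF that(1,2)]] PW_l2[OF PW_diff[OF that(2,3)]]]
    by (simp add: PW_norm_eq)
qed

interpretation PWm: Metric_space "PW \<alpha>" "\<lambda>F G. PW_norm (F - G)"
  by (rule PW_metric)

text \<open>Norm convergence controls every value of the function, with a factor depending only on \<open>n\<close>. So
a Cauchy sequence converges pointwise, and the equation, the growth bound and the square sum all
pass to the limit.\<close>
lemma PW_complete: "PWm.mcomplete"
  unfolding PWm.mcomplete_def
proof (intro allI impI)
  fix \<sigma> assume "PWm.MCauchy \<sigma>"
  then have \<sigma>: "\<sigma> k \<in> PW \<alpha>" and C: "\<And>\<epsilon>. \<epsilon> > 0 \<Longrightarrow> \<exists>N. \<forall>k k'. N \<le> k \<longrightarrow> N \<le> k' \<longrightarrow> PW_norm (\<sigma> k - \<sigma> k') < \<epsilon>" for k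
    unfolding PWm.MCauchy_def by auto
  let ?R = "growth_rate \<alpha>"
  note R = growth_rate_sq(1)[OF \<alpha>]
  have "Cauchy (\<lambda>k. \<sigma> k (m, n))" for m n
  proof (rule metric_CauchyI)
    fix e :: real assume "0 < e"
    then obtain N where N: "\<And>k k'. N \<le> k \<Longrightarrow> N \<le> k' \<Longrightarrow> PW_norm (\<sigma> k - \<sigma> k') < e / ?R ^ nat \<bar>n\<bar>"
      using C[of "e / ?R ^ nat \<bar>n\<bar>"] R by auto
    have "dist (\<sigma> k (m, n)) (\<sigma> k' (m, n)) < e" if "N \<le> k" "N \<le> k'" for k k'
    proof -
      have "dist (\<sigma> k (m, n)) (\<sigma> k' (m, n)) \<le> PW_norm (\<sigma> k - \<sigma> k') * ?R ^ nat \<bar>n\<bar>"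
        using PW_pointwise_bound[OF PW_diff[OF \<sigma>[of k] \<sigma>[of k']], of m n] by (simp add: dist_norm)
      also have "\<dots> < e" using N[OF that] R by (simp add: field_simps)
      finally show ?thesis .
    qed
    then show "\<exists>N. \<forall>k\<ge>N. \<forall>k'\<ge>N. dist (\<sigma> k (m, n)) (\<sigma> k' (m, n)) < e" by blast
  qed
  then have "\<exists>l. (\<lambda>k. \<sigma> k x) \<longlonglongrightarrow> l" for x
    by (cases x) (simp add: Cauchy_convergent_iff convergent_def)
  then obtain F where F: "\<And>x. (\<lambda>k. \<sigma> k x) \<longlonglongrightarrow> F x" by metis

  have tail: "l2 (\<lambda>m. \<sigma> k (m, 0) - F (m, 0))" "l2norm (\<lambda>m. \<sigma> k (m, 0) - F (m, 0)) \<le> \<epsilon>"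
    if N: "\<forall>k k'. N \<le> k \<longrightarrow> N \<le> k' \<longrightarrow> PW_norm (\<sigma> k - \<sigma> k') < \<epsilon>" and k: "N \<le> k" for N k \<epsilon>
  proof -
    have "(\<lambda>k'. \<sigma> k (m, 0) - \<sigma> k' (m, 0)) \<longlonglongrightarrow> \<sigma> k (m, 0) - F (m, 0)" for m
      by (intro tendsto_intros F)
    moreover have "l2norm (\<lambda>m. \<sigma> k (m, 0) - \<sigma> k' (m, 0)) \<le> \<epsilon>" if "N \<le> k'" for k'
      using N k that by (auto simp: PW_norm_diff less_imp_le)
    moreover have "l2 (\<lambda>m. \<sigma> k (m, 0) - \<sigma> k' (m, 0))" for k'
      by (intro l2_diff PW_l2 \<sigma>)
    ultimately show "l2 (\<lambda>m. \<sigma> k (m, 0) - F (m, 0))" "l2norm (\<lambda>m. \<sigma> k (m, 0) - F (m, 0)) \<le> \<epsilon>"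
      using l2_pointwise_limit[of "\<lambda>k' m. \<sigma> k (m, 0) - \<sigma> k' (m, 0)" "\<lambda>m. \<sigma> k (m, 0) - F (m, 0)" N \<epsilon>]
      by blast+
  qed

  have "F \<in> PW \<alpha>"
    unfolding PW_iff
  proof (intro conjI)
    have eq: "\<i> * \<sigma> k (m, n + 1) + \<sigma> k (m + 1, n + 1) = \<sigma> k (m, n) + \<i> * \<sigma> k (m + 1, n)" for k m n
      using \<sigma>[of k] by (simp add: PW_iff discrete_entire_iff)
    have "\<i> * F (m, n + 1) + F (m + 1, n + 1) = F (m, n) + \<i> * F (m + 1, n)" for m n
    proof (rule LIMSEQ_unique)
      show "(\<lambda>k. \<i> * \<sigma> k (m, n + 1) + \<sigma> k (m + 1, n + 1)) \<longlonglongrightarrow> \<i> * F (m, n + 1) + F (m + 1, n + 1)"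
        by (intro tendsto_intros F)
      show "(\<lambda>k. \<i> * \<sigma> k (m, n + 1) + \<sigma> k (m + 1, n + 1)) \<longlonglongrightarrow> F (m, n) + \<i> * F (m + 1, n)"
        unfolding eq by (intro tendsto_intros F)
    qed
    then show "discrete_entire F" by (simp add: discrete_entire_iff)
    obtain N where N: "\<forall>k k'. N \<le> k \<longrightarrow> N \<le> k' \<longrightarrow> PW_norm (\<sigma> k - \<sigma> k') < 1"
      using C[of 1] by auto
    have "l2 (\<lambda>m. \<sigma> N (m, 0) - (\<sigma> N (m, 0) - F (m, 0)))"
      by (intro l2_diff tail(1)[OF N] PW_l2 \<sigma>) simp
    then show "l2 (\<lambda>m. F (m, 0))" by simp
    define c where "c = PW_norm (\<sigma> N) + 1"
    have c: "c > 0" using PW.nrm_nonneg[OF \<sigma>[of N]] by (simp add: c_def)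
    have nrm: "PW_norm (\<sigma> k) \<le> c" if "N \<le> k" for k
      using l2_add(2)[OF PW_l2[OF PW_diff[OF \<sigma>[of k] \<sigma>[of N]]] PW_l2[OF \<sigma>[of N]]]
        N[rule_format, OF that order_refl]
      by (simp add: PW_norm_eq c_def)
    have "cmod (F (m, n)) \<le> c * ?R ^ nat \<bar>n\<bar>" for m n
    proof (rule LIMSEQ_le_const2[OF tendsto_norm[OF F]], intro exI allI impI)
      fix k assume "N \<le> k"
      show "cmod (\<sigma> k (m, n)) \<le> c * ?R ^ nat \<bar>n\<bar>"
        using R by (intro order_trans[OF PW_pointwise_bound[OF \<sigma>[of k]]] mult_right_mono nrm \<open>N \<le> k\<close>) simp
    qed
    then show "\<exists>c>0. \<forall>m n. cmod (F (m, n)) \<le> c * ?R ^ nat \<bar>n\<bar>" using c by blast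
  qed
  moreover have "\<exists>N. \<forall>k\<ge>N. \<sigma> k \<in> PW \<alpha> \<and> PW_norm (\<sigma> k - F) < e" if e: "0 < e" for e
  proof -
    obtain N where N: "\<forall>k k'. N \<le> k \<longrightarrow> N \<le> k' \<longrightarrow> PW_norm (\<sigma> k - \<sigma> k') < e / 2"
      using C[of "e / 2"] e by auto
    show ?thesis using tail(2)[OF N] e \<sigma> by (fastforce simp: PW_norm_diff intro!: exI[of _ N])
  qed
  ultimately show "\<exists>F. limitin PWm.mtopology \<sigma> F sequentially"
    unfolding PWm.limit_metric_sequentially by blast
qed

lemma PW_rkhs: "rkhs (PW \<alpha>) PW_inner PW_norm"
proof (intro rkhs.intro complex_hilbert_on.intro PW_inner_product)
  show "complex_hilbert_on_axioms (PW \<alpha>) PW_norm"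
    by (intro complex_hilbert_on_axioms.intro PW_metric PW_complete)
  show "rkhs_axioms (PW \<alpha>) PW_norm"
  proof
    show "\<exists>C. \<forall>F\<in>PW \<alpha>. cmod (F x) \<le> C * PW_norm F" for x
      using PW_pointwise_bound[of _ "fst x" "snd x"]
      by (intro exI[of _ "growth_rate \<alpha> ^ nat \<bar>snd x\<bar>"]) (simp add: mult.commute)
  qed
qed

lemma PW_kernel_reproducing: "reproducing_kernel (PW \<alpha>) PW_inner PW_kernel"
  unfolding reproducing_kernel_def using PW_kernel_in_PW PW_kernel_reproduces by blast

end

text \<open>Exchanging the arguments by Hermitian symmetry evaluates any reproducing kernel by any other, so
they all agree.\<close>
lemma (in complex_inner_product_on) reproducing_kernel_unique:
  assumes K: "reproducing_kernel V ip K" and L: "reproducing_kernel V ip L"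
  shows "K = L"
proof (intro ext)
  fix x y
  have swap: "M x y = cnj (L y x)" if M: "reproducing_kernel V ip M" for M
  proof -
    have in_V: "M x \<in> V" "L y \<in> V" using M L by (simp_all add: reproducing_kernel_def)
    have "M x y = ip (M x) (L y)" using L in_V by (simp add: reproducing_kernel_def)
    also have "\<dots> = cnj (ip (L y) (M x))" using inner_commute[OF in_V(2,1)] .
    also have "ip (L y) (M x) = L y x" using M in_V by (simp add: reproducing_kernel_def)
    finally show ?thesis .
  qed
  show "K x y = L x y" unfolding swap[OF K] swap[OF L] ..
qed

theorem corollary3p7:
  fixes \<alpha> :: real
  assumes "0 < \<alpha>" and "\<alpha> < pi / 2"
  shows "rkhs (PW \<alpha>) PW_inner PW_norm
    \<and> (\<exists>!K. reproducing_kernel (PW \<alpha>) PW_inner K)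
    \<and> (\<forall>K. reproducing_kernel (PW \<alpha>) PW_inner K \<longrightarrow>
        (\<forall>m n u v :: int.
          K (m, n) (u, v) =
            1 / (2 * pi) * (LINT t:D_set \<alpha>|lborel. discrete_exp t (u - m, v + n))
          \<and> K (m, n) (u, v) =
            1 / (2 * pi) * (LINT t:D_set \<alpha>|lborel. exp (\<i> * of_int (u - m) * t) *
              ((1 + \<i> * exp (\<i> * t)) / (\<i> + exp (\<i> * t))) powi (v + n))))"
proof (intro conjI allI impI)
  note unique = complex_inner_product_on.reproducing_kernel_unique[OF PW_inner_product[OF assms]]
  show "rkhs (PW \<alpha>) PW_inner PW_norm" by (rule PW_rkhs[OF assms])
  show "\<exists>!K. reproducing_kernel (PW \<alpha>) PW_inner K"
    using PW_kernel_reproducing[OF assms] unique by blast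
  fix K and m n u v :: int
  assume "reproducing_kernel (PW \<alpha>) PW_inner K"
  then have K: "K = PW_kernel \<alpha>" using PW_kernel_reproducing[OF assms] by (rule unique)
  show K1: "K (m, n) (u, v) = 1 / (2 * pi) * (LINT t:D_set \<alpha>|lborel. discrete_exp t (u - m, v + n))"
    unfolding K by (rule PW_kernel_integral[OF assms])
  show "K (m, n) (u, v) = 1 / (2 * pi) * (LINT t:D_set \<alpha>|lborel. exp (\<i> * of_int (u - m) * t) *
              ((1 + \<i> * exp (\<i> * t)) / (\<i> + exp (\<i> * t))) powi (v + n))"
    unfolding K1 discrete_exp_def by (simp add: mult_ac)
qed

end
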